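(* Let $M$ be a truth-value algebra, let $\Theta_\omega$ be the set of all formulas in $FORM_\omega$ that are true in $M$, let $\Sigma_\omega$ be the monoid of all endomorphisms of the free algebra $\mathrm{Free}_\omega(\mathbf{V}M)$, and let $X_\omega=\mathrm{Spec}\,\mathrm{Free}_\omega(\mathbf{V}M)$. Then the set $\Theta_\omega$ is equationally complete if and only if $\Sigma_\omega$ acts minimally on $X_\omega$.
   Context: Truth-value algebras. A t-norm is a continuous function $\star:[0,1]^2\to[0,1]$ such that $([0,1],\star,1)$ is a commutative monoid and $a\le b$ implies $c\star a\le c\star b$. Its residuum is $a\to b=\sup\{c: c\star a\le b\}$. An algebra is a set $A$ with two binary operations $\star,\to$ and two constants $0,1$; homomorphisms preserve all of these. A truth-value algebra is a subalgebra $M$ of $([0,1],\star,\to,0,1)$ for some t-norm $\star$ with residuum $\to$. $\mathbf{V}M$ is the equational class (variety) generated by $M$. Formulas. $FORM_\omega$ is the smallest set containing the propositional variables $x_i$ $(i<\omega)$ and the constants $0,1$, and closed under forming $(r\star s)$ and $(r\to s)$. A formula $r$ is true in $M$ if it takes value $1$ under every assignment of elements of $M$ to its variables. $\mathrm{Free}_\omega(\mathbf{V}M)$ is the free algebra in $\mathbf{V}M$ over the countably many generators $x_i$, $i<\omega$ (concretely, the subalgebra of $M^{(M^\omega)}$ generated by the coordinate projections); formulas are identified with the elements of it that they denote. Deductions. A substitution is a map $\sigma:FORM_\omega\to FORM_\omega$ with $\sigma(0)=0$, $\sigma(1)=1$, and $\sigma(r\circ s)=\sigma(r)\circ\sigma(s)$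 for $\circ\in\{\star,\to\}$. A deduction of $r$ from a set of formulas $\Theta$ is a finite sequence $r_1,\dots,r_h=r$ of formulas such that each $r_j$ either is in $\Theta$, or follows by Modus Ponens (there are $k,m<j$ such that $r_m$ is $r_k\to r_j$), or equals $\sigma(r_k)$ for some $k<j$ and some substitution $\sigma$. The set $\Theta\subseteq FORM_\omega$ is equationally complete if, for all $r,s\in FORM_\omega$ with $r\notin\Theta$, the formula $s$ is deducible from $\Theta\cup\{r\}$. Spectrum. Every algebra in $\mathbf{V}M$ is a lattice under $a\land b=a\star(a\to b)$ and $a\lor b=((a\to b)\to b)\land((b\to a)\to a)$. A filter of $A\in\mathbf{V}M$ is a set $\varphi^{-1}[1]$ for a homomorphism $\varphi$ with domain $A$ (into an algebra of $\mathbf{V}M$). A filter $\mathfrak{p}$ is prime if it is proper and, for all filters $\mathfrak{f},\mathfrak{g}$, $\mathfrak{p}=\mathfrak{f}\cap\mathfrak{g}$ implies $\mathfrak{p}=\mathfrak{f}$ or $\mathfrak{p}=\mathfrak{g}$. $\mathrm{Spec}\,A$ is the set of prime filters of $A$ with the topology having the sets $O_a=\{\mathfrak{p}: a\notin\mathfrak{p}\}$, $a\in A$, as an open subbasis. An endomorphism $\sigma$ of $A$ induces the continuous map $\sigma^*:\mathrm{Spec}\,A\to\mathrm{Spec}\,A$, $\sigma^*(\mathfrak{p})=\sigma^{-1}[\mathfrak{p}]$. Minimality. For $\Pi\subseteq\Sigma_\omega$ and $O\subseteq X_\omega$ open, $(\Pi,O)$ is the union of the sets $(\sigma^* )^{-1}[O]$,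 for $\sigma$ in the submonoid of $\Sigma_\omega$ generated by $\Pi$. $\Pi$ acts minimally on $X_\omega$ if $(\Pi,O)=X_\omega$ for every nonempty open $O$. *)

theory Defs
  imports "HOL-Analysis.Abstract_Topology" "HOL-Algebra.Group"
begin

section \<open>Algebras, homomorphisms, powers, generated subalgebras\<close>

text \<open>An algebra has two binary operations and two constants. The operation \<open>\<star>\<close> and the constant
  \<open>1\<close> are the \<^const>\<open>mult\<close> and \<^const>\<open>one\<close> of the library's monoid record; no monoid law is assumed.\<close>

record 'a alg = "'a monoid" +
  imp  :: "'a \<Rightarrow> 'a \<Rightarrow> 'a"  (infixr \<open>\<leadsto>\<index>\<close> 65)
  falsum :: 'a

definition subuniverse :: "'a set \<Rightarrow> 'a alg \<Rightarrow> bool" where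
  "subuniverse S A \<longleftrightarrow>
     S \<subseteq> carrier A \<and> falsum A \<in> S \<and> \<one>\<^bsub>A\<^esub> \<in> S \<and>
     (\<forall>a\<in>S. \<forall>b\<in>S. a \<otimes>\<^bsub>A\<^esub> b \<in> S \<and> a \<leadsto>\<^bsub>A\<^esub> b \<in> S)"

definition is_algebra :: "'a alg \<Rightarrow> bool" where
  "is_algebra A \<longleftrightarrow> subuniverse (carrier A) A"

definition alg_hom :: "'a alg \<Rightarrow> 'b alg \<Rightarrow> ('a \<Rightarrow> 'b) set" where
  "alg_hom A B =
     {\<phi> \<in> hom A B. (\<forall>a\<in>carrier A. \<forall>b\<in>carrier A. \<phi> (a \<leadsto>\<^bsub>A\<^esub> b) = \<phi> a \<leadsto>\<^bsub>B\<^esub> \<phi> b) \<and>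
        \<phi> (falsum A) = falsum B \<and> \<phi> \<one>\<^bsub>A\<^esub> = \<one>\<^bsub>B\<^esub>}"

definition power_alg :: "'i set \<Rightarrow> 'a alg \<Rightarrow> ('i \<Rightarrow> 'a) alg" where
  "power_alg I A =
     \<lparr>carrier = I \<rightarrow>\<^sub>E carrier A,
      mult = (\<lambda>f g. \<lambda>i\<in>I. f i \<otimes>\<^bsub>A\<^esub> g i),
      one = (\<lambda>i\<in>I. \<one>\<^bsub>A\<^esub>),
      imp = (\<lambda>f g. \<lambda>i\<in>I. f i \<leadsto>\<^bsub>A\<^esub> g i),
      falsum = (\<lambda>i\<in>I. falsum A)\<rparr>"

definition generated_subalgebra :: "'a alg \<Rightarrow> 'a set \<Rightarrow> 'a alg" where
  "generated_subalgebra A X = A\<lparr>carrier := \<Inter>{S. subuniverse S A \<and> X \<subseteq> S}\<rparr>"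


section \<open>Truth-value algebras\<close>

definition t_norm :: "(real \<Rightarrow> real \<Rightarrow> real) \<Rightarrow> bool" where
  "t_norm star \<longleftrightarrow>
     continuous_on ({0..1} \<times> {0..1}) (\<lambda>(a, b). star a b) \<and>
     comm_monoid \<lparr>carrier = {0..1}, mult = star, one = 1\<rparr> \<and>
     (\<forall>a\<in>{0..1}. \<forall>b\<in>{0..1}. \<forall>c\<in>{0..1}. a \<le> b \<longrightarrow> star c a \<le> star c b)"

definition residuum :: "(real \<Rightarrow> real \<Rightarrow> real) \<Rightarrow> real \<Rightarrow> real \<Rightarrow> real" where
  "residuum star a b = Sup {c \<in> {0..1}. star c a \<le> b}"

definition unit_interval_alg :: "(real \<Rightarrow> real \<Rightarrow> real) \<Rightarrow> real alg" where
  "unit_interval_alg star =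
     \<lparr>carrier = {0..1}, mult = star, one = 1, imp = residuum star, falsum = 0\<rparr>"

definition truth_value_algebra :: "real alg \<Rightarrow> bool" where
  "truth_value_algebra M \<longleftrightarrow>
     (\<exists>star S. t_norm star \<and> subuniverse S (unit_interval_alg star) \<and>
               M = (unit_interval_alg star)\<lparr>carrier := S\<rparr>)"


section \<open>Formulas and deductions\<close>

datatype form = Var nat | Falsum | Verum | Star form form | Imp form form

primrec eval :: "'a alg \<Rightarrow> (nat \<Rightarrow> 'a) \<Rightarrow> form \<Rightarrow> 'a" where
  "eval A v (Var i) = v i"
| "eval A v Falsum = falsum A"
| "eval A v Verum = \<one>\<^bsub>A\<^esub>"
| "eval A v (Star r s) = eval A v r \<otimes>\<^bsub>A\<^esub> eval A v s"
| "eval A v (Imp r s) = eval A v r \<leadsto>\<^bsub>A\<^esub> eval A v s"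

definition true_in :: "'a alg \<Rightarrow> form \<Rightarrow> bool" where
  "true_in M r \<longleftrightarrow> (\<forall>v \<in> UNIV \<rightarrow> carrier M. eval M v r = \<one>\<^bsub>M\<^esub>)"

definition substitution :: "(form \<Rightarrow> form) \<Rightarrow> bool" where
  "substitution \<sigma> \<longleftrightarrow>
     \<sigma> Falsum = Falsum \<and> \<sigma> Verum = Verum \<and>
     (\<forall>r s. \<sigma> (Star r s) = Star (\<sigma> r) (\<sigma> s) \<and> \<sigma> (Imp r s) = Imp (\<sigma> r) (\<sigma> s))"

definition is_deduction :: "form set \<Rightarrow> form list \<Rightarrow> bool" where
  "is_deduction \<Theta> rs \<longleftrightarrow>
     (\<forall>j < length rs.
        rs ! j \<in> \<Theta> \<or>
        (\<exists>k m. k < j \<and> m < j \<and> rs ! m = Imp (rs ! k) (rs ! j)) \<or>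
        (\<exists>k \<sigma>. k < j \<and> substitution \<sigma> \<and> rs ! j = \<sigma> (rs ! k)))"

definition deducible :: "form set \<Rightarrow> form \<Rightarrow> bool" where
  "deducible \<Theta> r \<longleftrightarrow> (\<exists>rs. rs \<noteq> [] \<and> last rs = r \<and> is_deduction \<Theta> rs)"

definition equationally_complete :: "form set \<Rightarrow> bool" where
  "equationally_complete \<Theta> \<longleftrightarrow> (\<forall>r s. r \<notin> \<Theta> \<longrightarrow> deducible (\<Theta> \<union> {r}) s)"


section \<open>The variety generated by an algebra, and its free algebra\<close>

text \<open>An equation is a pair of formulas. The equational class generated by \<open>M\<close> is the least class
  that is defined by a set of equations and contains \<open>M\<close>.\<close>

definition satisfies :: "'a alg \<Rightarrow> (form \<times> form) set \<Rightarrow> bool" where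
  "satisfies A E \<longleftrightarrow>
     (\<forall>(s, t) \<in> E. \<forall>v \<in> UNIV \<rightarrow> carrier A. eval A v s = eval A v t)"

definition in_variety :: "'m alg \<Rightarrow> 'a alg \<Rightarrow> bool" where
  "in_variety M A \<longleftrightarrow> is_algebra A \<and> (\<forall>E. satisfies M E \<longrightarrow> satisfies A E)"

text \<open>The free algebra over the generators \<open>x\<^sub>i\<close>, as the subalgebra of \<open>M\<close> to the power
  \<open>M\<^sup>\<omega>\<close> generated by the coordinate projections. An element is a function on \<open>M\<^sup>\<omega>\<close>, made
  extensional in the sense of the library.\<close>

definition free_alg :: "'m alg \<Rightarrow> ((nat \<Rightarrow> 'm) \<Rightarrow> 'm) alg" where
  "free_alg M =
     generated_subalgebra (power_alg (UNIV \<rightarrow>\<^sub>E carrier M) M)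
       (range (\<lambda>i. \<lambda>v \<in> UNIV \<rightarrow>\<^sub>E carrier M. v i))"


section \<open>Filters and spectrum\<close>

text \<open>In the following, \<open>A\<close> is meant to belong to the variety generated by \<open>M\<close>.

  HOL does not quantify over the carrier type of the codomain of \<open>\<phi>\<close>. The type \<open>'a set\<close>, which
  hosts the quotients of \<open>A\<close>, is general enough: see \<open>is_filter_kernel\<close> below.\<close>

definition is_filter :: "'m alg \<Rightarrow> 'a alg \<Rightarrow> 'a set \<Rightarrow> bool" where
  "is_filter M A \<ff> \<longleftrightarrow>
     (\<exists>(B :: 'a set alg) \<phi>. in_variety M B \<and> \<phi> \<in> alg_hom A B \<and>
        \<ff> = {a \<in> carrier A. \<phi> a = \<one>\<^bsub>B\<^esub>})"

definition is_prime_filter :: "'m alg \<Rightarrow> 'a alg \<Rightarrow> 'a set \<Rightarrow> bool" where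
  "is_prime_filter M A \<pp> \<longleftrightarrow>
     is_filter M A \<pp> \<and> \<pp> \<noteq> carrier A \<and>
     (\<forall>\<ff> \<gg>. is_filter M A \<ff> \<longrightarrow> is_filter M A \<gg> \<longrightarrow> \<pp> = \<ff> \<inter> \<gg> \<longrightarrow> \<pp> = \<ff> \<or> \<pp> = \<gg>)"

definition Spec :: "'m alg \<Rightarrow> 'a alg \<Rightarrow> 'a set set" where
  "Spec M A = {\<pp>. is_prime_filter M A \<pp>}"

definition basic_open :: "'m alg \<Rightarrow> 'a alg \<Rightarrow> 'a \<Rightarrow> 'a set set" where
  "basic_open M A a = {\<pp> \<in> Spec M A. a \<notin> \<pp>}"

definition Spec_topology :: "'m alg \<Rightarrow> 'a alg \<Rightarrow> 'a set topology" where
  "Spec_topology M A = topology_generated_by (basic_open M A ` carrier A)"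


section \<open>Endomorphisms and minimality\<close>

definition End :: "'a alg \<Rightarrow> ('a \<Rightarrow> 'a) monoid" where
  "End A =
     \<lparr>carrier = alg_hom A A \<inter> extensional (carrier A),
      mult = compose (carrier A),
      one = (\<lambda>a\<in>carrier A. a)\<rparr>"

definition generated_submonoid :: "'a monoid \<Rightarrow> 'a set \<Rightarrow> 'a set" where
  "generated_submonoid G X = \<Inter>{H. submonoid H G \<and> X \<subseteq> H}"

definition dual_map :: "'a alg \<Rightarrow> ('a \<Rightarrow> 'a) \<Rightarrow> 'a set \<Rightarrow> 'a set" where
  "dual_map A \<sigma> \<pp> = {a \<in> carrier A. \<sigma> a \<in> \<pp>}"

definition saturation :: "'m alg \<Rightarrow> 'a alg \<Rightarrow> ('a \<Rightarrow> 'a) set \<Rightarrow> 'a set set \<Rightarrow> 'a set set" where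
  "saturation M A S U =
     (\<Union>\<sigma> \<in> generated_submonoid (End A) S. {\<pp> \<in> Spec M A. dual_map A \<sigma> \<pp> \<in> U})"

definition acts_minimally :: "'m alg \<Rightarrow> 'a alg \<Rightarrow> ('a \<Rightarrow> 'a) set \<Rightarrow> bool" where
  "acts_minimally M A S \<longleftrightarrow>
     (\<forall>U. openin (Spec_topology M A) U \<longrightarrow> U \<noteq> {} \<longrightarrow> saturation M A S U = Spec M A)"


section \<open>Consistency of the definitions\<close>

lemma eval_closed:
  assumes "is_algebra A" "\<And>i. v i \<in> carrier A"
  shows "eval A v r \<in> carrier A"
  using assms by (induction r) (auto simp: is_algebra_def subuniverse_def)

lemma alg_hom_eval:
  assumes "is_algebra A" "\<phi> \<in> alg_hom A B" "\<And>i. v i \<in> carrier A"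
  shows "\<phi> (eval A v r) = eval B (\<phi> \<circ> v) r"
  using assms(2,3) eval_closed[OF assms(1,3)]
  by (induction r) (auto simp: alg_hom_def hom_def)

lemma topspace_Spec_topology:
  assumes "is_algebra A"
  shows "topspace (Spec_topology M A) = Spec M A"
proof -
  have "\<exists>a\<in>carrier A. a \<notin> \<pp>" if "\<pp> \<in> Spec M A" for \<pp>
    using that unfolding Spec_def is_prime_filter_def is_filter_def by blast
  then show ?thesis
    by (auto simp: Spec_topology_def basic_open_def)
qed

text \<open>The kernel of a homomorphism into an algebra of the variety over any type whatsoever is a
  filter in the sense of \<^const>\<open>is_filter\<close>.\<close>

lemma is_filter_kernel:
  fixes A :: "'a alg" and B :: "'b alg"
  assumes A: "is_algebra A" and B: "in_variety M B" and \<phi>: "\<phi> \<in> alg_hom A B"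
  shows "is_filter M A {a \<in> carrier A. \<phi> a = \<one>\<^bsub>B\<^esub>}"
proof -
  define h where "h b = {a \<in> carrier A. \<phi> a = b}" for b
  define g where "g P = \<phi> (SOME a. a \<in> P)" for P
  define Q :: "'a set alg" where
    "Q = \<lparr>carrier = h ` \<phi> ` carrier A, mult = (\<lambda>P R. h (g P \<otimes>\<^bsub>B\<^esub> g R)), one = h \<one>\<^bsub>B\<^esub>,
          imp = (\<lambda>P R. h (g P \<leadsto>\<^bsub>B\<^esub> g R)), falsum = h (falsum B)\<rparr>"
  have gh: "g (h (\<phi> a)) = \<phi> a" if "a \<in> carrier A" for a
    unfolding g_def h_def using that by (rule_tac someI2[of _ a]) auto
  have clA: "falsum A \<in> carrier A" "\<one>\<^bsub>A\<^esub> \<in> carrier A"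
    "\<And>a b. a \<in> carrier A \<Longrightarrow> b \<in> carrier A \<Longrightarrow> a \<otimes>\<^bsub>A\<^esub> b \<in> carrier A"
    "\<And>a b. a \<in> carrier A \<Longrightarrow> b \<in> carrier A \<Longrightarrow> a \<leadsto>\<^bsub>A\<^esub> b \<in> carrier A"
    using A by (auto simp: is_algebra_def subuniverse_def)
  have hm: "\<phi> (falsum A) = falsum B" "\<phi> \<one>\<^bsub>A\<^esub> = \<one>\<^bsub>B\<^esub>"
    "\<And>a b. a \<in> carrier A \<Longrightarrow> b \<in> carrier A \<Longrightarrow> \<phi> (a \<otimes>\<^bsub>A\<^esub> b) = \<phi> a \<otimes>\<^bsub>B\<^esub> \<phi> b"
    "\<And>a b. a \<in> carrier A \<Longrightarrow> b \<in> carrier A \<Longrightarrow> \<phi> (a \<leadsto>\<^bsub>A\<^esub> b) = \<phi> a \<leadsto>\<^bsub>B\<^esub> \<phi> b"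
    "\<And>a. a \<in> carrier A \<Longrightarrow> \<phi> a \<in> carrier B"
    using \<phi> by (auto simp: alg_hom_def hom_def)
  have \<psi>: "(\<lambda>a. h (\<phi> a)) \<in> alg_hom A Q"
    by (auto simp: alg_hom_def hom_def Q_def gh clA hm)
  have Qalg: "is_algebra Q"
    unfolding is_algebra_def subuniverse_def
  proof (intro conjI ballI)
    show "falsum Q \<in> carrier Q" "\<one>\<^bsub>Q\<^esub> \<in> carrier Q"
      using clA(1,2) hm(1,2) by (force simp: Q_def)+
    fix P R assume "P \<in> carrier Q" "R \<in> carrier Q"
    then obtain a b where ab: "a \<in> carrier A" "b \<in> carrier A" "P = h (\<phi> a)" "R = h (\<phi> b)"
      by (auto simp: Q_def)
    have "P \<otimes>\<^bsub>Q\<^esub> R = h (\<phi> (a \<otimes>\<^bsub>A\<^esub> b))" "P \<leadsto>\<^bsub>Q\<^esub> R = h (\<phi> (a \<leadsto>\<^bsub>A\<^esub> b))"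
      using ab by (auto simp: Q_def gh hm)
    then show "P \<otimes>\<^bsub>Q\<^esub> R \<in> carrier Q" "P \<leadsto>\<^bsub>Q\<^esub> R \<in> carrier Q"
      using ab(1,2) clA(3,4) by (auto simp: Q_def)
  qed auto
  have "satisfies Q E" if "satisfies M E" for E
    unfolding satisfies_def
  proof (clarify)
    fix s t and v :: "nat \<Rightarrow> 'a set"
    assume st: "(s, t) \<in> E" and v: "v \<in> UNIV \<rightarrow> carrier Q"
    have "\<exists>a. a \<in> carrier A \<and> v i = h (\<phi> a)" for i
    proof -
      have "v i \<in> carrier Q"
        using v by auto
      then show ?thesis
        by (auto simp: Q_def)
    qed
    then obtain w where w: "\<And>i. w i \<in> carrier A" "\<And>i. v i = h (\<phi> (w i))"
      by metis
    have "satisfies B E"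
      using B that by (auto simp: in_variety_def)
    then have "eval B (\<phi> \<circ> w) s = eval B (\<phi> \<circ> w) t"
      using st w(1) hm(5) by (auto simp: satisfies_def)
    then have "\<phi> (eval A w s) = \<phi> (eval A w t)"
      by (simp add: alg_hom_eval[OF A \<phi> w(1)])
    moreover have "v = (\<lambda>a. h (\<phi> a)) \<circ> w"
      using w(2) by auto
    ultimately show "eval Q v s = eval Q v t"
      by (simp add: alg_hom_eval[OF A \<psi> w(1), symmetric])
  qed
  then have "in_variety M Q"
    using Qalg by (auto simp: in_variety_def)
  moreover have "{a \<in> carrier A. \<phi> a = \<one>\<^bsub>B\<^esub>} = {a \<in> carrier A. h (\<phi> a) = \<one>\<^bsub>Q\<^esub>}"
  proof -
    have "\<phi> a = \<one>\<^bsub>B\<^esub> \<longleftrightarrow> h (\<phi> a) = h \<one>\<^bsub>B\<^esub>" if "a \<in> carrier A" for a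
      by (metis clA(2) gh hm(2) that)
    then show ?thesis
      by (auto simp: Q_def)
  qed
  ultimately show ?thesis
    unfolding is_filter_def using \<psi> by blast
qed

end

theory Submission
  imports Defs "HOL-Analysis.Elementary_Metric_Spaces"
begin

text \<open>Write \<open>F\<close> for the free algebra and \<open>[r]\<close> for the element of \<open>F\<close> denoted by a formula \<open>r\<close>. Both sides
  of the equivalence say that for every element \<open>a \<noteq> 1\<close> of \<open>F\<close> the images of \<open>a\<close> under all endomorphisms
  lie in no common prime filter.

  On the logical side, \<open>r\<close> is true in \<open>M\<close> iff \<open>[r] = 1\<close>, endomorphisms of \<open>F\<close> are the maps induced by
  substitutions, and Modus Ponens is the closure property of filters. So the formulas deducible from
  \<open>r\<close> and the truths of \<open>M\<close> form the filter generated by the endomorphic images of \<open>[r]\<close>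
  (\<open>deducible_in_filter\<close>, \<open>filter_deducible\<close>). Completeness says that this filter is improper whenever
  \<open>[r] \<noteq> 1\<close>, and by Zorn's lemma a filter is improper iff no prime filter contains it
  (\<open>prime_filter_extends\<close>).

  On the topological side, the sets \<open>O\<^sub>a\<close> form a basis and not only a subbasis
  (\<open>basic_open_Int\<close>), and \<open>O\<^sub>a\<close> is nonempty iff \<open>a \<noteq> 1\<close>, because evaluation at a point is a map onto a
  subchain of \<open>M\<close> and hence has a prime kernel (\<open>prime_filter_at_point\<close>). Since
  \<open>\<sigma>\<^sup>*(\<pp>) \<in> O\<^sub>a\<close> means \<open>\<sigma>(a) \<notin> \<pp>\<close>, minimality says that every prime \<open>\<pp>\<close> misses some \<open>\<sigma>(a)\<close>, for each
  \<open>a \<noteq> 1\<close>.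

  Two algebraic facts make this work. Filters, defined as kernels of homomorphisms into the variety,
  are exactly the subsets of \<open>F\<close> that contain \<open>1\<close> and are closed under Modus Ponens
  (\<open>is_filter_iff\<close>). Prime filters, defined by indecomposability under intersection, are exactly the
  proper filters with totally ordered quotient (\<open>prime_filter_iff\<close>); this is what shows that
  \<open>\<sigma>\<^sup>*\<close> preserves primeness.

  The argument takes place in a nontrivial bounded residuated chain \<open>M\<close>. A truth-value algebra is one
  because continuity of the t-norm makes the supremum defining the residuum a maximum
  (\<open>t_norm_residuation\<close>).\<close>

section \<open>Deductions\<close>

lemma deducible_base: "r \<in> \<Theta> \<Longrightarrow> deducible \<Theta> r"
  unfolding deducible_def is_deduction_def by (rule exI[of _ "[r]"]) simp

lemma is_deduction_append:
  assumes "is_deduction \<Theta> rs" "is_deduction \<Theta> ss"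
  shows "is_deduction \<Theta> (rs @ ss)"
  unfolding is_deduction_def
proof (intro allI impI)
  fix j assume j: "j < length (rs @ ss)"
  show "(rs @ ss) ! j \<in> \<Theta> \<or>
        (\<exists>k m. k < j \<and> m < j \<and> (rs @ ss) ! m = Imp ((rs @ ss) ! k) ((rs @ ss) ! j)) \<or>
        (\<exists>k \<sigma>. k < j \<and> substitution \<sigma> \<and> (rs @ ss) ! j = \<sigma> ((rs @ ss) ! k))"
  proof (cases "j < length rs")
    case True
    then have "(rs @ ss) ! k = rs ! k" if "k \<le> j" for k
      using that by (simp add: nth_append)
    then show ?thesis
      using assms(1) True unfolding is_deduction_def by (metis less_imp_le order_refl)
  next
    case False
    then obtain i where i: "j = length rs + i" "i < length ss"
      using j by (metis add_less_cancel_left le_Suc_ex length_append not_less)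
    consider "ss ! i \<in> \<Theta>"
      | k m where "k < i" "m < i" "ss ! m = Imp (ss ! k) (ss ! i)"
      | k \<sigma> where "k < i" "substitution \<sigma>" "ss ! i = \<sigma> (ss ! k)"
      using assms(2) i(2) unfolding is_deduction_def by blast
    then show ?thesis
    proof cases
      case 1
      then show ?thesis by (simp add: i)
    next
      case (2 k m)
      then show ?thesis
        by (intro disjI2 disjI1 exI[of _ "length rs + k"] exI[of _ "length rs + m"]) (simp add: i)
    next
      case (3 k \<sigma>)
      then show ?thesis
        by (intro disjI2 exI[of _ "length rs + k"] exI[of _ \<sigma>]) (simp add: i)
    qed
  qed
qed

lemma is_deduction_snoc:
  assumes "is_deduction \<Theta> rs"
    and "r \<in> \<Theta> \<or> (\<exists>s\<in>set rs. Imp s r \<in> set rs) \<or> (\<exists>s\<in>set rs. \<exists>\<sigma>. substitution \<sigma> \<and> r = \<sigma> s)"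
  shows "is_deduction \<Theta> (rs @ [r])"
  unfolding is_deduction_def
proof (intro allI impI)
  fix j assume "j < length (rs @ [r])"
  then consider "j < length rs" | "j = length rs" by fastforce
  then show "(rs @ [r]) ! j \<in> \<Theta> \<or>
        (\<exists>k m. k < j \<and> m < j \<and> (rs @ [r]) ! m = Imp ((rs @ [r]) ! k) ((rs @ [r]) ! j)) \<or>
        (\<exists>k \<sigma>. k < j \<and> substitution \<sigma> \<and> (rs @ [r]) ! j = \<sigma> ((rs @ [r]) ! k))"
  proof cases
    case 1
    then have "(rs @ [r]) ! k = rs ! k" if "k \<le> j" for k
      using that by (simp add: nth_append)
    then show ?thesis
      using assms(1) 1 unfolding is_deduction_def by (metis less_imp_le order_refl)
  next
    case 2
    have old: "\<exists>k<j. (rs @ [r]) ! k = s" if "s \<in> set rs" for s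
      using that 2 by (metis in_set_conv_nth nth_append)
    have "(rs @ [r]) ! j = r"
      using 2 by simp
    then show ?thesis
      using assms(2) old by metis
  qed
qed

lemma deducible_mp:
  assumes "deducible \<Theta> r" "deducible \<Theta> (Imp r s)"
  shows "deducible \<Theta> s"
proof -
  obtain rs ss where rs: "rs \<noteq> []" "last rs = r" "is_deduction \<Theta> rs"
    and ss: "ss \<noteq> []" "last ss = Imp r s" "is_deduction \<Theta> ss"
    using assms unfolding deducible_def by blast
  have "r \<in> set (rs @ ss)" "Imp r s \<in> set (rs @ ss)"
    using rs(1,2) ss(1,2) last_in_set[of rs] last_in_set[of ss] by auto
  then have "is_deduction \<Theta> ((rs @ ss) @ [s])"
    by (intro is_deduction_snoc is_deduction_append rs ss) blast
  then show ?thesis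
    unfolding deducible_def by (intro exI[of _ "(rs @ ss) @ [s]"]) simp
qed

lemma deducible_substitution:
  assumes "deducible \<Theta> r" "substitution \<sigma>"
  shows "deducible \<Theta> (\<sigma> r)"
proof -
  obtain rs where rs: "rs \<noteq> []" "last rs = r" "is_deduction \<Theta> rs"
    using assms unfolding deducible_def by blast
  then have "is_deduction \<Theta> (rs @ [\<sigma> r])"
    using assms(2) last_in_set[of rs] by (intro is_deduction_snoc) auto
  then show ?thesis
    unfolding deducible_def by (intro exI[of _ "rs @ [\<sigma> r]"]) simp
qed

lemma deducible_induct [consumes 1, case_names base mp substitution]:
  assumes "deducible \<Theta> r"
    and base: "\<And>r. r \<in> \<Theta> \<Longrightarrow> P r"
    and mp: "\<And>r s. P r \<Longrightarrow> P (Imp r s) \<Longrightarrow> P s"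
    and subst: "\<And>r \<sigma>. P r \<Longrightarrow> substitution \<sigma> \<Longrightarrow> P (\<sigma> r)"
  shows "P r"
proof -
  obtain rs where rs: "rs \<noteq> []" "last rs = r" "is_deduction \<Theta> rs"
    using assms(1) unfolding deducible_def by blast
  have "P (rs ! j)" if "j < length rs" for j
    using that
  proof (induction j rule: less_induct)
    case (less j)
    consider "rs ! j \<in> \<Theta>"
      | k m where "k < j" "m < j" "rs ! m = Imp (rs ! k) (rs ! j)"
      | k \<sigma> where "k < j" "substitution \<sigma>" "rs ! j = \<sigma> (rs ! k)"
      using rs(3) less.prems unfolding is_deduction_def by blast
    then show ?case
    proof cases
      case 1
      then show ?thesis by (rule base)
    next
      case 2
      then have "P (rs ! k)" "P (rs ! m)"
        using less.IH less.prems by (meson less_trans)+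
      then show ?thesis
        using 2(3) mp by metis
    next
      case 3
      then have "P (rs ! k)"
        using less.IH less.prems by (meson less_trans)
      then show ?thesis
        using 3(2,3) subst by metis
    qed
  qed
  then show ?thesis
    using rs(1,2) by (metis diff_less last_conv_nth length_greater_0_conv zero_less_one)
qed

lemma eval_substitution:
  assumes "substitution \<sigma>"
  shows "eval A v (\<sigma> r) = eval A (\<lambda>i. eval A v (\<sigma> (Var i))) r"
  using assms by (induction r) (auto simp: substitution_def)

lemma substitution_comp:
  "substitution \<sigma> \<Longrightarrow> substitution \<rho> \<Longrightarrow> substitution (\<lambda>r. \<sigma> (\<rho> r))"
  by (simp add: substitution_def)

text \<open>A substitution with prescribed values at the variables: by freeness every endomorphism of the free
  algebra comes from one of these.\<close>

primrec instantiate :: "(nat \<Rightarrow> form) \<Rightarrow> form \<Rightarrow> form" where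
  "instantiate \<theta> (Var i) = \<theta> i"
| "instantiate \<theta> Falsum = Falsum"
| "instantiate \<theta> Verum = Verum"
| "instantiate \<theta> (Star r s) = Star (instantiate \<theta> r) (instantiate \<theta> s)"
| "instantiate \<theta> (Imp r s) = Imp (instantiate \<theta> r) (instantiate \<theta> s)"

lemma substitution_instantiate: "substitution (instantiate \<theta>)"
  by (simp add: substitution_def)


section \<open>Filters and homomorphic images in a variety\<close>

text \<open>The syntactic description of a filter, free of homomorphisms. For the free algebra it turns
  out to be equivalent to \<^const>\<open>is_filter\<close>.\<close>

definition implicative_filter :: "'a alg \<Rightarrow> 'a set \<Rightarrow> bool" where
  "implicative_filter A G \<longleftrightarrow>
     G \<subseteq> carrier A \<and> \<one>\<^bsub>A\<^esub> \<in> G \<and> (\<forall>a\<in>G. \<forall>b\<in>carrier A. a \<leadsto>\<^bsub>A\<^esub> b \<in> G \<longrightarrow> b \<in> G)"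

lemma implicative_filter_mp:
  "implicative_filter A G \<Longrightarrow> a \<in> G \<Longrightarrow> a \<leadsto>\<^bsub>A\<^esub> b \<in> G \<Longrightarrow> b \<in> carrier A \<Longrightarrow> b \<in> G"
  unfolding implicative_filter_def by blast

lemma implicative_filter_INT:
  assumes "I \<noteq> {}" "\<And>i. i \<in> I \<Longrightarrow> implicative_filter A (G i)"
  shows "implicative_filter A (\<Inter>i\<in>I. G i)"
  using assms unfolding implicative_filter_def by (intro conjI ballI impI; blast)

lemma alg_homD:
  assumes "\<phi> \<in> alg_hom A B"
  shows "\<phi> (falsum A) = falsum B" "\<phi> \<one>\<^bsub>A\<^esub> = \<one>\<^bsub>B\<^esub>"
    "\<And>a b. a \<in> carrier A \<Longrightarrow> b \<in> carrier A \<Longrightarrow> \<phi> (a \<otimes>\<^bsub>A\<^esub> b) = \<phi> a \<otimes>\<^bsub>B\<^esub> \<phi> b"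
    "\<And>a b. a \<in> carrier A \<Longrightarrow> b \<in> carrier A \<Longrightarrow> \<phi> (a \<leadsto>\<^bsub>A\<^esub> b) = \<phi> a \<leadsto>\<^bsub>B\<^esub> \<phi> b"
    "\<And>a. a \<in> carrier A \<Longrightarrow> \<phi> a \<in> carrier B"
  using assms by (auto simp: alg_hom_def hom_def)

lemma algebra_closed:
  assumes "is_algebra A"
  shows "falsum A \<in> carrier A" "\<one>\<^bsub>A\<^esub> \<in> carrier A"
    "\<And>a b. a \<in> carrier A \<Longrightarrow> b \<in> carrier A \<Longrightarrow> a \<otimes>\<^bsub>A\<^esub> b \<in> carrier A"
    "\<And>a b. a \<in> carrier A \<Longrightarrow> b \<in> carrier A \<Longrightarrow> a \<leadsto>\<^bsub>A\<^esub> b \<in> carrier A"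
  using assms by (auto simp: is_algebra_def subuniverse_def)

text \<open>Equations pass to homomorphic images, as every valuation in the image lifts along the
  surjection. This puts quotients of the free algebra into the variety.\<close>

lemma in_variety_hom_image:
  assumes A: "in_variety M A" and \<phi>: "\<phi> \<in> alg_hom A B" and surj: "\<phi> ` carrier A = carrier B"
  shows "in_variety M B"
proof -
  have algA: "is_algebra A"
    using A by (simp add: in_variety_def)
  note cl = algebra_closed[OF algA] and hm = alg_homD[OF \<phi>]
  have "is_algebra B"
    unfolding is_algebra_def subuniverse_def
  proof (intro conjI ballI)
    show "falsum B \<in> carrier B" "\<one>\<^bsub>B\<^esub> \<in> carrier B"
      using cl(1,2) hm(1,2) surj by (metis imageI)+
    fix x y assume "x \<in> carrier B" "y \<in> carrier B"
    then obtain a b where "a \<in> carrier A" "b \<in> carrier A" "x = \<phi> a" "y = \<phi> b"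
      using surj by (metis imageE)
    then show "x \<otimes>\<^bsub>B\<^esub> y \<in> carrier B" "x \<leadsto>\<^bsub>B\<^esub> y \<in> carrier B"
      using cl(3,4) hm(3,4,5) by metis+
  qed auto
  moreover have "satisfies B E" if "satisfies M E" for E
    unfolding satisfies_def
  proof clarify
    fix s t and v :: "nat \<Rightarrow> _" assume st: "(s, t) \<in> E" and v: "v \<in> UNIV \<rightarrow> carrier B"
    have "\<forall>i. \<exists>a. a \<in> carrier A \<and> v i = \<phi> a"
      using v surj by (metis PiE UNIV_I imageE)
    then obtain w where w: "\<And>i. w i \<in> carrier A" "\<And>i. v i = \<phi> (w i)"
      by metis
    have "satisfies A E"
      using A that by (simp add: in_variety_def)
    then have "eval A w s = eval A w t"
      using st w(1) by (auto simp: satisfies_def)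
    moreover have "v = \<phi> \<circ> w"
      using w(2) by auto
    ultimately show "eval B v s = eval B v t"
      by (simp add: alg_hom_eval[OF algA \<phi> w(1), symmetric])
  qed
  ultimately show ?thesis
    by (simp add: in_variety_def)
qed

lemma generated_submonoid_End:
  assumes A: "is_algebra A"
  shows "generated_submonoid (End A) (carrier (End A)) = carrier (End A)"
proof -
  have "submonoid (carrier (End A)) (End A)"
  proof
    show "\<one>\<^bsub>End A\<^esub> \<in> carrier (End A)"
      by (auto simp: End_def alg_hom_def hom_def algebra_closed[OF A])
    fix \<sigma> \<tau> assume "\<sigma> \<in> carrier (End A)" "\<tau> \<in> carrier (End A)"
    then have "\<sigma> \<in> alg_hom A A" "\<tau> \<in> alg_hom A A"
      by (auto simp: End_def)
    from alg_homD[OF this(1)] alg_homD[OF this(2)]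
    show "\<sigma> \<otimes>\<^bsub>End A\<^esub> \<tau> \<in> carrier (End A)"
      by (auto simp: End_def alg_hom_def hom_def algebra_closed[OF A] compose_def)
  qed auto
  then show ?thesis
    by (auto simp: generated_submonoid_def)
qed


section \<open>Residuated chains\<close>

text \<open>Residuation makes \<open>\<rightarrow>\<close> adjoint to \<open>\<star>\<close> and yields all inequalities below. Totality of the order is
  the source of prime filters: evaluation of a formula takes values in a chain.\<close>

locale residuated_chain = comm_monoid M for M :: "'m::linorder alg" (structure) +
  assumes is_algebra_M: "is_algebra M"
    and residuation: "\<lbrakk>a \<in> carrier M; b \<in> carrier M; c \<in> carrier M\<rbrakk> \<Longrightarrow> c \<otimes> a \<le> b \<longleftrightarrow> c \<le> a \<leadsto> b"
    and falsum_least: "a \<in> carrier M \<Longrightarrow> falsum M \<le> a"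
    and one_greatest: "a \<in> carrier M \<Longrightarrow> a \<le> \<one>"
    and nontrivial: "falsum M \<noteq> \<one>"
begin

lemmas closed = algebra_closed[OF is_algebra_M]

lemma imp_mult_le: "\<lbrakk>a \<in> carrier M; b \<in> carrier M\<rbrakk> \<Longrightarrow> (a \<leadsto> b) \<otimes> a \<le> b"
  using residuation closed(4) by blast

lemma mult_mono_right:
  assumes "a \<in> carrier M" "b \<in> carrier M" "c \<in> carrier M" "a \<le> b"
  shows "a \<otimes> c \<le> b \<otimes> c"
proof -
  have "a \<le> c \<leadsto> b \<otimes> c"
    using residuation[of c "b \<otimes> c" b] assms closed(3) by auto
  then show ?thesis
    using residuation[of c "b \<otimes> c" a] assms closed(3) by blast
qed

lemma mult_mono:
  assumes "a \<in> carrier M" "b \<in> carrier M" "c \<in> carrier M" "d \<in> carrier M" "a \<le> b" "c \<le> d"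
  shows "a \<otimes> c \<le> b \<otimes> d"
proof -
  have "a \<otimes> c \<le> b \<otimes> c"
    using assms mult_mono_right by blast
  also have "\<dots> = c \<otimes> b"
    using assms m_comm by blast
  also have "\<dots> \<le> d \<otimes> b"
    using assms mult_mono_right by blast
  also have "\<dots> = b \<otimes> d"
    using assms m_comm by blast
  finally show ?thesis .
qed

lemma mult_le_left: "\<lbrakk>a \<in> carrier M; b \<in> carrier M\<rbrakk> \<Longrightarrow> a \<otimes> b \<le> a"
  using mult_mono[of a a b \<one>] one_greatest closed by (simp add: r_one)

lemma imp_eq_one_iff:
  "\<lbrakk>a \<in> carrier M; b \<in> carrier M\<rbrakk> \<Longrightarrow> a \<leadsto> b = \<one> \<longleftrightarrow> a \<le> b"
  using residuation[of a b \<one>] one_greatest[of "a \<leadsto> b"] closed by auto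

lemma one_imp: "a \<in> carrier M \<Longrightarrow> \<one> \<leadsto> a = a"
  using residuation[of \<one> a a] imp_mult_le[of \<one> a] closed by auto

lemma le_imp_mult: "\<lbrakk>a \<in> carrier M; b \<in> carrier M\<rbrakk> \<Longrightarrow> a \<le> b \<leadsto> a \<otimes> b"
  using residuation closed(3) by blast

lemma le_imp: "\<lbrakk>a \<in> carrier M; b \<in> carrier M\<rbrakk> \<Longrightarrow> a \<le> b \<leadsto> a"
  using residuation mult_le_left by blast

lemma imp_le_imp_mult:
  assumes "a \<in> carrier M" "b \<in> carrier M" "c \<in> carrier M"
  shows "a \<leadsto> b \<le> a \<otimes> c \<leadsto> b \<otimes> c"
proof -
  have "(a \<leadsto> b) \<otimes> (a \<otimes> c) \<le> b \<otimes> c"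
    using mult_mono_right[OF _ _ _ imp_mult_le] assms closed by (simp add: m_assoc[symmetric])
  then show ?thesis
    using residuation assms closed by simp
qed

lemma imp_le_imp_imp:
  assumes "a \<in> carrier M" "b \<in> carrier M" "c \<in> carrier M"
  shows "a \<leadsto> b \<le> (b \<leadsto> c) \<leadsto> (a \<leadsto> c)"
proof -
  have "(a \<leadsto> b) \<otimes> (b \<leadsto> c) \<otimes> a = (b \<leadsto> c) \<otimes> ((a \<leadsto> b) \<otimes> a)"
    using assms closed by (simp add: m_ac)
  also have "\<dots> \<le> (b \<leadsto> c) \<otimes> b"
    using assms closed by (intro mult_mono imp_mult_le) auto
  also have "\<dots> \<le> c"
    using assms by (intro imp_mult_le)
  finally show ?thesis
    using residuation assms closed by simp
qed

lemma imp_le_imp_imp_left: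
  assumes "a \<in> carrier M" "b \<in> carrier M" "c \<in> carrier M"
  shows "b \<leadsto> c \<le> (a \<leadsto> b) \<leadsto> (a \<leadsto> c)"
proof -
  have "(a \<leadsto> b) \<otimes> (b \<leadsto> c) \<le> a \<leadsto> c"
    using imp_le_imp_imp[of a b c] residuation assms closed by simp
  then show ?thesis
    using residuation[of "a \<leadsto> b" "a \<leadsto> c" "b \<leadsto> c"] m_comm assms closed by simp
qed

lemma le_imp_imp:
  assumes "a \<in> carrier M" "b \<in> carrier M"
  shows "a \<le> (a \<leadsto> b) \<leadsto> b"
proof -
  have "a \<otimes> (a \<leadsto> b) \<le> b"
    using imp_mult_le[OF assms] m_comm[of a "a \<leadsto> b"] assms closed by simp
  then show ?thesis
    using residuation assms closed by simp
qed

text \<open>Modus Ponens relative to a disjunct \<open>c\<close>. In a chain each hypothesis is witnessed by one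
  of its two bounds, and a product lies below both of its factors, so a single product is enough
  although \<open>\<star>\<close> is not idempotent.\<close>

lemma max_imp_mult_le:
  assumes "a \<in> carrier M" "b \<in> carrier M" "c \<in> carrier M" "x \<in> carrier M" "y \<in> carrier M"
    and "x \<le> max a c" "y \<le> max (a \<leadsto> b) c"
  shows "y \<otimes> x \<le> max b c"
proof -
  consider "x \<le> c" | "y \<le> c" | "x \<le> a" "y \<le> a \<leadsto> b"
    using assms(6,7) by (auto simp: le_max_iff_disj)
  then show ?thesis
  proof cases
    case 1
    then have "y \<otimes> x \<le> c"
      using mult_le_left[of x y] assms(4,5) m_comm[of x y] by auto
    then show ?thesis by (simp add: le_max_iff_disj)
  next
    case 2
    then have "y \<otimes> x \<le> c"
      using mult_le_left[of y x] assms(4,5) by auto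
    then show ?thesis by (simp add: le_max_iff_disj)
  next
    case 3
    then have "y \<otimes> x \<le> (a \<leadsto> b) \<otimes> a"
      using assms closed 3 by (intro mult_mono) auto
    then show ?thesis
      using imp_mult_le[of a b] assms(1,2) by (auto simp: le_max_iff_disj)
  qed
qed


section \<open>The free algebra\<close>

abbreviation F where "F \<equiv> free_alg M"

abbreviation points where "points \<equiv> (UNIV :: nat set) \<rightarrow>\<^sub>E carrier M"

text \<open>The element of the free algebra that a formula denotes.\<close>

definition term_function :: "form \<Rightarrow> (nat \<Rightarrow> 'm) \<Rightarrow> 'm" where
  "term_function r = (\<lambda>v\<in>points. eval M v r)"

lemma points_iff: "v \<in> points \<longleftrightarrow> (\<forall>i. v i \<in> carrier M)"
  by (auto simp: PiE_def)

lemma eval_M_closed: "v \<in> points \<Longrightarrow> eval M v r \<in> carrier M"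
  by (rule eval_closed[OF is_algebra_M]) (simp add: points_iff)

lemma term_function_operations:
  "falsum F = term_function Falsum" "\<one>\<^bsub>F\<^esub> = term_function Verum"
  "term_function r \<otimes>\<^bsub>F\<^esub> term_function s = term_function (Star r s)"
  "term_function r \<leadsto>\<^bsub>F\<^esub> term_function s = term_function (Imp r s)"
  by (auto simp: free_alg_def generated_subalgebra_def power_alg_def term_function_def
      intro!: restrict_ext)

lemma carrier_F: "carrier F = range term_function"
proof -
  let ?P = "power_alg points M"
  let ?X = "range (\<lambda>i. \<lambda>v\<in>points. v i)"
  have ops: "falsum ?P = term_function Falsum" "\<one>\<^bsub>?P\<^esub> = term_function Verum"
    "\<And>r s. term_function r \<otimes>\<^bsub>?P\<^esub> term_function s = term_function (Star r s)"
    "\<And>r s. term_function r \<leadsto>\<^bsub>?P\<^esub> term_function s = term_function (Imp r s)"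
    by (auto simp: power_alg_def term_function_def intro!: restrict_ext)
  have "term_function r \<in> carrier ?P" for r
    using eval_M_closed by (simp add: power_alg_def term_function_def)
  then have sub: "subuniverse (range term_function) ?P"
    by (auto simp: subuniverse_def ops)
  have gen: "?X \<subseteq> range term_function"
  proof clarify
    fix i
    have "(\<lambda>v\<in>points. v i) = term_function (Var i)"
      by (simp add: term_function_def)
    then show "(\<lambda>v\<in>points. v i) \<in> range term_function"
      by simp
  qed
  have "term_function r \<in> S" if S: "subuniverse S ?P" "?X \<subseteq> S" for S r
  proof (induction r)
    case (Var i)
    have "(\<lambda>v\<in>points. v i) \<in> S"
      using S(2) by (rule subsetD) (rule rangeI)
    then show ?case
      by (simp only: term_function_def eval.simps)
  qed (use S(1) in \<open>auto simp: subuniverse_def simp flip: ops\<close>)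
  then have "\<Inter>{S. subuniverse S ?P \<and> ?X \<subseteq> S} = range term_function"
    using sub gen by blast
  then show ?thesis
    by (simp add: free_alg_def generated_subalgebra_def)
qed

lemma is_algebra_F: "is_algebra F"
  by (auto simp: is_algebra_def subuniverse_def carrier_F term_function_operations)

lemmas F_closed = algebra_closed[OF is_algebra_F]

lemma F_apply:
  assumes "v \<in> points"
  shows "falsum F v = falsum M" "\<one>\<^bsub>F\<^esub> v = \<one>" "(f \<otimes>\<^bsub>F\<^esub> g) v = f v \<otimes> g v"
    "(f \<leadsto>\<^bsub>F\<^esub> g) v = f v \<leadsto> g v"
  using assms by (simp_all add: free_alg_def generated_subalgebra_def power_alg_def)

lemma F_value: "f \<in> carrier F \<Longrightarrow> v \<in> points \<Longrightarrow> f v \<in> carrier M"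
  using eval_M_closed by (auto simp: carrier_F term_function_def)

lemma F_eqI:
  assumes "f \<in> carrier F" "g \<in> carrier F" "\<And>v. v \<in> points \<Longrightarrow> f v = g v"
  shows "f = g"
proof -
  have "f \<in> extensional points" "g \<in> extensional points"
    using assms(1,2) by (auto simp: carrier_F term_function_def)
  then show ?thesis
    using assms(3) by (rule extensionalityI)
qed

lemma F_mult_commute:
  "f \<in> carrier F \<Longrightarrow> g \<in> carrier F \<Longrightarrow> f \<otimes>\<^bsub>F\<^esub> g = g \<otimes>\<^bsub>F\<^esub> f"
  by (rule F_eqI) (auto simp: F_closed F_apply F_value m_comm)

lemma eval_F_apply:
  assumes "v \<in> points" "\<And>i. w i \<in> carrier F"
  shows "eval F w r v = eval M (\<lambda>i. w i v) r"
  using assms by (induction r) (auto simp: F_apply)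

lemma eval_F_term_function:
  "eval F (\<lambda>i. term_function (\<theta> i)) r = term_function (instantiate \<theta> r)"
  by (induction r) (simp_all add: term_function_operations)

lemma instantiate_Var: "instantiate Var r = r"
  by (induction r) auto

lemma in_variety_F: "in_variety M F"
proof -
  have "satisfies F E" if "satisfies M E" for E
    unfolding satisfies_def
  proof clarify
    fix s t and w :: "nat \<Rightarrow> _" assume st: "(s, t) \<in> E" and "w \<in> UNIV \<rightarrow> carrier F"
    then have w: "\<And>i. w i \<in> carrier F" by auto
    show "eval F w s = eval F w t"
    proof (rule F_eqI)
      fix v assume v: "v \<in> points"
      then have "eval M (\<lambda>i. w i v) s = eval M (\<lambda>i. w i v) t"
        using that st F_value[OF w v] by (auto simp: satisfies_def)
      then show "eval F w s v = eval F w t v"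
        by (simp add: eval_F_apply v w)
    qed (auto intro: eval_closed is_algebra_F w)
  qed
  then show ?thesis
    by (simp add: in_variety_def is_algebra_F)
qed

text \<open>The order of the free algebra is pointwise. Inequalities of the chain therefore become
  memberships in filters.\<close>

lemma F_imp_eq_one_iff:
  assumes "f \<in> carrier F" "g \<in> carrier F"
  shows "f \<leadsto>\<^bsub>F\<^esub> g = \<one>\<^bsub>F\<^esub> \<longleftrightarrow> (\<forall>v\<in>points. f v \<le> g v)"
proof -
  have "f \<leadsto>\<^bsub>F\<^esub> g = \<one>\<^bsub>F\<^esub> \<longleftrightarrow> (\<forall>v\<in>points. (f \<leadsto>\<^bsub>F\<^esub> g) v = \<one>\<^bsub>F\<^esub> v)"
    using F_eqI[of "f \<leadsto>\<^bsub>F\<^esub> g" "\<one>\<^bsub>F\<^esub>"] F_closed assms by auto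
  also have "\<dots> \<longleftrightarrow> (\<forall>v\<in>points. f v \<le> g v)"
    using F_value assms by (auto simp: F_apply imp_eq_one_iff)
  finally show ?thesis .
qed

lemma true_in_iff: "true_in M r \<longleftrightarrow> term_function r = \<one>\<^bsub>F\<^esub>"
proof -
  have "term_function r = \<one>\<^bsub>F\<^esub> \<longleftrightarrow> (\<forall>v\<in>points. term_function r v = \<one>\<^bsub>F\<^esub> v)"
    using F_eqI[of "term_function r" "\<one>\<^bsub>F\<^esub>"] F_closed(2) by (auto simp: carrier_F)
  then show ?thesis
    by (auto simp: true_in_def term_function_def F_apply PiE_def)
qed


section \<open>Filters of the free algebra\<close>

abbreviation filter_F where "filter_F \<equiv> implicative_filter F"

lemma filter_upward:
  assumes "filter_F G" "f \<in> G" "g \<in> carrier F" "\<And>v. v \<in> points \<Longrightarrow> f v \<le> g v"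
  shows "g \<in> G"
proof -
  have "f \<leadsto>\<^bsub>F\<^esub> g = \<one>\<^bsub>F\<^esub>"
    using assms by (subst F_imp_eq_one_iff) (auto simp: implicative_filter_def)
  then show ?thesis
    using assms(1-3) by (metis implicative_filter_def)
qed

lemma filter_mult:
  assumes G: "filter_F G" and "f \<in> G" "g \<in> G"
  shows "f \<otimes>\<^bsub>F\<^esub> g \<in> G"
proof -
  have fg: "f \<in> carrier F" "g \<in> carrier F"
    using assms by (auto simp: implicative_filter_def)
  have "g \<leadsto>\<^bsub>F\<^esub> f \<otimes>\<^bsub>F\<^esub> g \<in> G"
    by (rule filter_upward[OF G \<open>f \<in> G\<close>])
      (auto simp: fg F_closed F_apply F_value le_imp_mult)
  then show ?thesis
    using G \<open>g \<in> G\<close> fg F_closed(3) by (metis implicative_filter_mp)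
qed

lemma filter_falsum:
  assumes "filter_F G" "falsum F \<in> G"
  shows "G = carrier F"
proof
  show "G \<subseteq> carrier F"
    using assms(1) by (simp add: implicative_filter_def)
  show "carrier F \<subseteq> G"
    by (rule subsetI, rule filter_upward[OF assms]) (auto simp: F_apply F_value falsum_least)
qed

text \<open>Closure under Modus Ponens of a kernel comes from the equation \<open>1 \<rightarrow> x = x\<close>, which every
  algebra of the variety inherits from \<open>M\<close>.\<close>

lemma is_filter_imp_filter_F:
  assumes "is_filter M F G"
  shows "filter_F G"
proof -
  obtain B and \<phi> :: "_ \<Rightarrow> ((nat \<Rightarrow> 'm) \<Rightarrow> 'm) set" where B: "in_variety M B"
    and \<phi>: "\<phi> \<in> alg_hom F B" and G: "G = {a \<in> carrier F. \<phi> a = \<one>\<^bsub>B\<^esub>}"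
    using assms unfolding is_filter_def by blast
  note hm = alg_homD[OF \<phi>]
  have "satisfies M {(Imp Verum (Var 0), Var 0)}"
    by (auto simp: satisfies_def Pi_iff one_imp)
  then have "satisfies B {(Imp Verum (Var 0), Var 0)}"
    using B by (simp add: in_variety_def)
  then have "\<forall>v \<in> (UNIV :: nat set) \<rightarrow> carrier B. \<one>\<^bsub>B\<^esub> \<leadsto>\<^bsub>B\<^esub> v 0 = v 0"
    by (simp add: satisfies_def)
  then have one_imp_B: "\<one>\<^bsub>B\<^esub> \<leadsto>\<^bsub>B\<^esub> b = b" if "b \<in> carrier B" for b
    using that bspec[of _ _ "\<lambda>_. b"] by blast
  show ?thesis
    unfolding implicative_filter_def
  proof (intro conjI ballI impI)
    fix a b assume "a \<in> G" "b \<in> carrier F" "a \<leadsto>\<^bsub>F\<^esub> b \<in> G"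
    then show "b \<in> G"
      using hm(4)[of a b] one_imp_B[of "\<phi> b"] hm(5)[of b] by (auto simp: G)
  qed (auto simp: G F_closed hm)
qed

definition filter_cong where
  "filter_cong G f g \<longleftrightarrow> f \<leadsto>\<^bsub>F\<^esub> g \<in> G \<and> g \<leadsto>\<^bsub>F\<^esub> f \<in> G"

lemma filter_cong_sym: "filter_cong G f g \<Longrightarrow> filter_cong G g f"
  by (simp add: filter_cong_def)

context
  fixes G assumes G: "filter_F G"
begin

lemma filter_cong_refl: "f \<in> carrier F \<Longrightarrow> filter_cong G f f"
  using G F_imp_eq_one_iff[of f f] by (auto simp: filter_cong_def implicative_filter_def)

lemma filter_imp_trans:
  assumes "f \<in> carrier F" "g \<in> carrier F" "h \<in> carrier F"
    "f \<leadsto>\<^bsub>F\<^esub> g \<in> G"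
  shows "(g \<leadsto>\<^bsub>F\<^esub> h) \<leadsto>\<^bsub>F\<^esub> (f \<leadsto>\<^bsub>F\<^esub> h) \<in> G"
  by (rule filter_upward[OF G assms(4)])
    (auto simp: assms(1-3) F_closed F_apply F_value imp_le_imp_imp)

lemma filter_cong_trans:
  assumes "f \<in> carrier F" "g \<in> carrier F" "h \<in> carrier F"
    "filter_cong G f g" "filter_cong G g h"
  shows "filter_cong G f h"
  using assms filter_imp_trans implicative_filter_mp[OF G] F_closed(4)
  unfolding filter_cong_def by meson

lemma filter_cong_mult1:
  assumes "f \<in> carrier F" "g \<in> carrier F" "h \<in> carrier F" "filter_cong G f g"
  shows "filter_cong G (f \<otimes>\<^bsub>F\<^esub> h) (g \<otimes>\<^bsub>F\<^esub> h)"
  using assms(4) unfolding filter_cong_def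
  by (elim conjE, intro conjI; elim filter_upward[OF G])
    (auto simp: assms(1-3) F_closed F_apply F_value imp_le_imp_mult)

lemma filter_cong_imp1:
  assumes "f \<in> carrier F" "g \<in> carrier F" "h \<in> carrier F" "filter_cong G f g"
  shows "filter_cong G (f \<leadsto>\<^bsub>F\<^esub> h) (g \<leadsto>\<^bsub>F\<^esub> h)"
  using assms filter_imp_trans unfolding filter_cong_def by blast

lemma filter_cong_imp2:
  assumes "f \<in> carrier F" "g \<in> carrier F" "h \<in> carrier F" "filter_cong G f g"
  shows "filter_cong G (h \<leadsto>\<^bsub>F\<^esub> f) (h \<leadsto>\<^bsub>F\<^esub> g)"
proof -
  have "(h \<leadsto>\<^bsub>F\<^esub> x) \<leadsto>\<^bsub>F\<^esub> (h \<leadsto>\<^bsub>F\<^esub> y) \<in> G"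
    if "x \<in> carrier F" "y \<in> carrier F" "x \<leadsto>\<^bsub>F\<^esub> y \<in> G" for x y
    by (rule filter_upward[OF G that(3)])
      (auto simp: that(1,2) assms(3) F_closed F_apply F_value imp_le_imp_imp_left)
  then show ?thesis
    using assms unfolding filter_cong_def by blast
qed

lemma filter_cong_mult:
  assumes "f \<in> carrier F" "f' \<in> carrier F" "g \<in> carrier F" "g' \<in> carrier F"
    "filter_cong G f f'" "filter_cong G g g'"
  shows "filter_cong G (f \<otimes>\<^bsub>F\<^esub> g) (f' \<otimes>\<^bsub>F\<^esub> g')"
proof -
  have "filter_cong G (f \<otimes>\<^bsub>F\<^esub> g) (f' \<otimes>\<^bsub>F\<^esub> g)"
    using filter_cong_mult1 assms by blast
  moreover have "filter_cong G (f' \<otimes>\<^bsub>F\<^esub> g) (f' \<otimes>\<^bsub>F\<^esub> g')"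
    using filter_cong_mult1[of g g' f'] assms F_mult_commute by metis
  ultimately show ?thesis
    using filter_cong_trans F_closed(3) assms(1-4) by meson
qed

lemma filter_cong_imp:
  assumes "f \<in> carrier F" "f' \<in> carrier F" "g \<in> carrier F" "g' \<in> carrier F"
    "filter_cong G f f'" "filter_cong G g g'"
  shows "filter_cong G (f \<leadsto>\<^bsub>F\<^esub> g) (f' \<leadsto>\<^bsub>F\<^esub> g')"
  using filter_cong_imp1[of f f' g] filter_cong_imp2[of g g' f'] filter_cong_trans F_closed(4) assms
  by meson

lemma filter_cong_one: "f \<in> carrier F \<Longrightarrow> filter_cong G f \<one>\<^bsub>F\<^esub> \<longleftrightarrow> f \<in> G"
proof -
  assume f: "f \<in> carrier F"
  have "f \<leadsto>\<^bsub>F\<^esub> \<one>\<^bsub>F\<^esub> = \<one>\<^bsub>F\<^esub>"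
    using f F_closed(2) F_value by (auto simp: F_imp_eq_one_iff F_apply one_greatest)
  moreover have "\<one>\<^bsub>F\<^esub> \<leadsto>\<^bsub>F\<^esub> f = f"
    using f F_closed F_value by (intro F_eqI) (auto simp: F_apply one_imp)
  ultimately show ?thesis
    using G by (simp add: filter_cong_def implicative_filter_def)
qed

text \<open>The quotient by the congruence of \<open>G\<close> is built on representatives: \<open>h\<close> chooses one element
  of each class, and the operations of the quotient are those of the free algebra followed by \<open>h\<close>.\<close>

lemma filter_F_imp_is_filter: "is_filter M F G"
proof -
  \<comment> \<open>a normal form for the congruence of \<open>G\<close>\<close>
  define h where "h f = (SOME g. g \<in> carrier F \<and> filter_cong G f g)" for f
  have h: "h f \<in> carrier F" "filter_cong G f (h f)" if "f \<in> carrier F" for f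
    using someI_ex[of "\<lambda>g. g \<in> carrier F \<and> filter_cong G f g"] filter_cong_refl that
    unfolding h_def by blast+
  have h_cong: "h f = h g" if "f \<in> carrier F" "g \<in> carrier F" "filter_cong G f g" for f g
  proof -
    have "(\<lambda>k. k \<in> carrier F \<and> filter_cong G f k) = (\<lambda>k. k \<in> carrier F \<and> filter_cong G g k)"
      using that filter_cong_trans filter_cong_sym by blast
    then show ?thesis
      by (simp add: h_def)
  qed
  have h_eq_iff: "h f = h g \<longleftrightarrow> filter_cong G f g" if "f \<in> carrier F" "g \<in> carrier F" for f g
    using that h h_cong filter_cong_trans filter_cong_sym by metis
  define B where "B = \<lparr>carrier = h ` carrier F, mult = (\<lambda>f g. h (f \<otimes>\<^bsub>F\<^esub> g)), one = h \<one>\<^bsub>F\<^esub>,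
    imp = (\<lambda>f g. h (f \<leadsto>\<^bsub>F\<^esub> g)), falsum = h (falsum F)\<rparr>"
  have hom: "h \<in> alg_hom F B"
    using h h_cong filter_cong_mult filter_cong_imp
    by (auto simp: alg_hom_def hom_def B_def F_closed intro!: h_cong)
  have "in_variety M B"
    by (rule in_variety_hom_image[OF in_variety_F hom]) (simp add: B_def)
  then have "is_filter M F {f \<in> carrier F. h f = \<one>\<^bsub>B\<^esub>}"
    using is_filter_kernel[OF is_algebra_F _ hom] by blast
  moreover have "{f \<in> carrier F. h f = \<one>\<^bsub>B\<^esub>} = G"
    using h_eq_iff filter_cong_one F_closed(2) G by (auto simp: B_def implicative_filter_def)
  ultimately show ?thesis by simp
qed

end

lemma is_filter_iff: "is_filter M F G \<longleftrightarrow> filter_F G"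
  using is_filter_imp_filter_F filter_F_imp_is_filter by blast


section \<open>Prime filters\<close>

text \<open>This is \<open>{d. d \<or> c \<in> G}\<close>. Writing it with a lower bound \<open>e\<close> avoids the need for a term that denotes
  the pointwise maximum.\<close>

definition polar where
  "polar G c = {d \<in> carrier F. \<exists>e\<in>G. \<forall>v\<in>points. e v \<le> max (d v) (c v)}"

lemma polar_superset: "filter_F G \<Longrightarrow> G \<subseteq> polar G c"
proof
  fix e assume "filter_F G" "e \<in> G"
  moreover have "\<forall>v\<in>points. e v \<le> max (e v) (c v)"
    by simp
  ultimately show "e \<in> polar G c"
    unfolding polar_def implicative_filter_def by blast
qed

lemma filter_polar:
  assumes G: "filter_F G" and c: "c \<in> carrier F"
  shows "filter_F (polar G c)"
  unfolding implicative_filter_def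
proof (intro conjI ballI impI)
  show "polar G c \<subseteq> carrier F"
    by (auto simp: polar_def)
  show "\<one>\<^bsub>F\<^esub> \<in> polar G c"
    using G polar_superset[OF G] by (auto simp: implicative_filter_def)
  fix a b assume "a \<in> polar G c" and b: "b \<in> carrier F" and "a \<leadsto>\<^bsub>F\<^esub> b \<in> polar G c"
  then obtain x y where a: "a \<in> carrier F" and xy: "x \<in> G" "y \<in> G"
    and x: "\<And>v. v \<in> points \<Longrightarrow> x v \<le> max (a v) (c v)"
    and y: "\<And>v. v \<in> points \<Longrightarrow> y v \<le> max ((a \<leadsto>\<^bsub>F\<^esub> b) v) (c v)"
    by (auto simp: polar_def)
  have xyF: "x \<in> carrier F" "y \<in> carrier F"
    using xy G by (auto simp: implicative_filter_def)
  have "(y \<otimes>\<^bsub>F\<^esub> x) v \<le> max (b v) (c v)" if v: "v \<in> points" for v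
    using max_imp_mult_le[of "a v" "b v" "c v" "x v" "y v"] x[OF v] y[OF v] F_value a b c xyF v
    by (simp add: F_apply)
  then show "b \<in> polar G c"
    using b filter_mult[OF G xy(2,1)] unfolding polar_def by blast
qed

lemma polar_sym: "c \<in> carrier F \<Longrightarrow> d \<in> polar G c \<Longrightarrow> c \<in> polar G d"
  unfolding polar_def by (simp add: max.commute)

lemma polar_self: "filter_F G \<Longrightarrow> c \<in> polar G c \<Longrightarrow> c \<in> G"
proof -
  assume G: "filter_F G" and "c \<in> polar G c"
  then obtain e where "c \<in> carrier F" "e \<in> G" "\<forall>v\<in>points. e v \<le> c v"
    by (auto simp: polar_def)
  then show "c \<in> G"
    using filter_upward[OF G] by blast
qed

text \<open>Put \<open>u = f \<rightarrow> g\<close> and \<open>w = g \<rightarrow> f\<close>; their pointwise maximum is \<open>1\<close>. The filter \<open>A = {d. d \<or> w \<in> p}\<close>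
  contains \<open>u\<close>, and \<open>B = {d. \<forall>c\<in>A. d \<or> c \<in> p}\<close> contains \<open>w\<close>. They meet in \<open>p\<close>, since \<open>d \<in> A \<inter> B\<close>
  gives \<open>d \<or> d \<in> p\<close>. Primeness then puts \<open>u\<close> or \<open>w\<close> into \<open>p\<close>. Using such polars instead of the filters
  generated by \<open>p\<close> and \<open>u\<close> (or \<open>w\<close>) makes computations with powers of \<open>u\<close> and \<open>w\<close> unnecessary.\<close>

lemma prime_filter_linear:
  assumes p: "is_prime_filter M F p" and f: "f \<in> carrier F" and g: "g \<in> carrier F"
  shows "f \<leadsto>\<^bsub>F\<^esub> g \<in> p \<or> g \<leadsto>\<^bsub>F\<^esub> f \<in> p"
proof -
  let ?u = "f \<leadsto>\<^bsub>F\<^esub> g" and ?w = "g \<leadsto>\<^bsub>F\<^esub> f"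
  have fil: "filter_F p"
    using p by (simp add: is_prime_filter_def is_filter_iff)
  have uw: "?u \<in> carrier F" "?w \<in> carrier F"
    using f g F_closed by auto
  let ?A = "polar p ?w" and ?B = "\<Inter>c\<in>polar p ?w. polar p c"
  have A: "filter_F ?A"
    using filter_polar fil uw by blast
  have oneA: "\<one>\<^bsub>F\<^esub> \<in> ?A"
    using A by (simp add: implicative_filter_def)
  have AF: "?A \<subseteq> carrier F"
    using A by (simp add: implicative_filter_def)
  have B: "filter_F ?B"
    using oneA AF fil by (intro implicative_filter_INT filter_polar) auto
  have "?u \<in> ?A"
  proof -
    have "\<one> \<le> max (?u v) (?w v)" if "v \<in> points" for v
    proof (cases "f v \<le> g v")
      case True
      then have "?u v = \<one>"
        using that f g F_value by (simp add: F_apply imp_eq_one_iff)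
      then show ?thesis by (simp add: le_max_iff_disj)
    next
      case False
      then have "?w v = \<one>"
        using that f g F_value by (simp add: F_apply imp_eq_one_iff)
      then show ?thesis by (simp add: le_max_iff_disj)
    qed
    moreover have "\<one>\<^bsub>F\<^esub> \<in> p"
      using fil by (simp add: implicative_filter_def)
    ultimately have "\<exists>e\<in>p. \<forall>v\<in>points. e v \<le> max (?u v) (?w v)"
      by (metis F_apply(2))
    then show ?thesis
      using uw by (simp add: polar_def)
  qed
  moreover have "?w \<in> ?B"
    using polar_sym uw by blast
  moreover have "p = ?A \<inter> ?B"
    using polar_superset[OF fil] polar_self[OF fil] by blast
  then have "p = ?A \<or> p = ?B"
    using p A B unfolding is_prime_filter_def is_filter_iff by blast
  ultimately show ?thesis by blast
qed

text \<open>If \<open>p\<close> were the intersection of two larger filters \<open>A\<close> and \<open>B\<close>, take \<open>f \<in> A - B\<close> and \<open>g \<in> B - A\<close>: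
  whichever of the two implications lies in \<open>p\<close> moves \<open>f\<close> into \<open>B\<close> or \<open>g\<close> into \<open>A\<close>.\<close>

lemma linear_filter_prime:
  assumes p: "filter_F p" "falsum F \<notin> p"
    and lin: "\<And>f g. f \<in> carrier F \<Longrightarrow> g \<in> carrier F \<Longrightarrow> f \<leadsto>\<^bsub>F\<^esub> g \<in> p \<or> g \<leadsto>\<^bsub>F\<^esub> f \<in> p"
  shows "is_prime_filter M F p"
  unfolding is_prime_filter_def is_filter_iff
proof (intro conjI allI impI)
  show "p \<noteq> carrier F"
    using p(2) F_closed(1) by blast
  fix A B assume A: "filter_F A" and B: "filter_F B" and pAB: "p = A \<inter> B"
  show "p = A \<or> p = B"
  proof (rule ccontr)
    assume "\<not> (p = A \<or> p = B)"
    then obtain f g where fg: "f \<in> A" "f \<notin> B" "g \<in> B" "g \<notin> A"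
      using pAB by blast
    then have "f \<in> carrier F" "g \<in> carrier F"
      using A B by (auto simp: implicative_filter_def)
    then show False
      using lin[of f g] fg pAB implicative_filter_mp[OF A, of f g] implicative_filter_mp[OF B, of g f]
      by blast
  qed
qed (rule p)

lemma prime_filter_iff:
  "is_prime_filter M F p \<longleftrightarrow> filter_F p \<and> falsum F \<notin> p \<and>
     (\<forall>f\<in>carrier F. \<forall>g\<in>carrier F. f \<leadsto>\<^bsub>F\<^esub> g \<in> p \<or> g \<leadsto>\<^bsub>F\<^esub> f \<in> p)"
proof
  assume p: "is_prime_filter M F p"
  then have "filter_F p" "p \<noteq> carrier F"
    by (auto simp: is_prime_filter_def is_filter_iff)
  then show "filter_F p \<and> falsum F \<notin> p \<and>
     (\<forall>f\<in>carrier F. \<forall>g\<in>carrier F. f \<leadsto>\<^bsub>F\<^esub> g \<in> p \<or> g \<leadsto>\<^bsub>F\<^esub> f \<in> p)"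
    using filter_falsum prime_filter_linear[OF p] by blast
qed (blast intro: linear_filter_prime)

text \<open>Evaluation at \<open>v\<close> takes values in a chain, so its kernel decides between \<open>f \<rightarrow> g\<close> and
  \<open>g \<rightarrow> f\<close>.\<close>

lemma prime_filter_at_point:
  assumes v: "v \<in> points"
  shows "is_prime_filter M F {f \<in> carrier F. f v = \<one>}"
  unfolding prime_filter_iff implicative_filter_def
proof (intro conjI ballI impI)
  show "falsum F \<notin> {f \<in> carrier F. f v = \<one>}"
    using v nontrivial by (simp add: F_apply)
  fix f g assume fg: "f \<in> carrier F" "g \<in> carrier F"
  have "f v \<le> g v \<or> g v \<le> f v"
    by (rule linear)
  then show "f \<leadsto>\<^bsub>F\<^esub> g \<in> {f \<in> carrier F. f v = \<one>} \<or> g \<leadsto>\<^bsub>F\<^esub> f \<in> {f \<in> carrier F. f v = \<one>}"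
    using fg v by (auto simp: F_apply F_closed F_value imp_eq_one_iff)
next
  fix f g assume "f \<in> {f \<in> carrier F. f v = \<one>}" "g \<in> carrier F"
    "f \<leadsto>\<^bsub>F\<^esub> g \<in> {f \<in> carrier F. f v = \<one>}"
  then show "g \<in> {f \<in> carrier F. f v = \<one>}"
    using v F_value one_imp by (auto simp: F_apply)
qed (use v F_closed in \<open>auto simp: F_apply\<close>)

lemma basic_open_nonempty:
  assumes "\<not> true_in M r"
  shows "basic_open M F (term_function r) \<noteq> {}"
proof -
  obtain v where v: "v \<in> points" "eval M v r \<noteq> \<one>"
    using assms by (auto simp: true_in_def PiE_def)
  have "{f \<in> carrier F. f v = \<one>} \<in> basic_open M F (term_function r)"
    using v prime_filter_at_point by (simp add: basic_open_def Spec_def term_function_def)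
  then show ?thesis by blast
qed

text \<open>By Zorn's lemma there is a maximal proper filter above \<open>G\<close>; it is prime because the only
  filters containing it are itself and the whole algebra.\<close>

lemma prime_filter_extends:
  assumes G: "filter_F G" "falsum F \<notin> G"
  obtains p where "is_prime_filter M F p" "G \<subseteq> p"
proof -
  define \<A> where "\<A> = {H. filter_F H \<and> falsum F \<notin> H \<and> G \<subseteq> H}"
  have "\<exists>p\<in>\<A>. \<forall>X\<in>\<A>. p \<subseteq> X \<longrightarrow> X = p"
  proof (rule subset_Zorn_nonempty)
    show "\<A> \<noteq> {}"
      using G by (auto simp: \<A>_def)
    fix \<C> assume \<C>: "\<C> \<noteq> {}" "subset.chain \<A> \<C>"
    have mem: "filter_F H" "falsum F \<notin> H" "G \<subseteq> H" if "H \<in> \<C>" for H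
      using \<C>(2) that by (auto simp: subset.chain_def \<A>_def)
    have "filter_F (\<Union>\<C>)"
      unfolding implicative_filter_def
    proof (intro conjI ballI impI)
      show "\<Union>\<C> \<subseteq> carrier F" "\<one>\<^bsub>F\<^esub> \<in> \<Union>\<C>"
        using mem(1) \<C>(1) by (auto simp: implicative_filter_def)
      fix a b assume "a \<in> \<Union>\<C>" and b: "b \<in> carrier F" and "a \<leadsto>\<^bsub>F\<^esub> b \<in> \<Union>\<C>"
      then obtain H K where HK: "H \<in> \<C>" "K \<in> \<C>" "a \<in> H" "a \<leadsto>\<^bsub>F\<^esub> b \<in> K"
        by blast
      then have "H \<subseteq> K \<or> K \<subseteq> H"
        using \<C>(2) by (auto simp: subset.chain_def)
      then show "b \<in> \<Union>\<C>"
        using HK b implicative_filter_mp[OF mem(1)] by blast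
    qed
    then show "\<Union>\<C> \<in> \<A>"
      using mem \<C>(1) unfolding \<A>_def by blast
  qed
  then obtain p where p: "p \<in> \<A>" and max: "\<And>X. X \<in> \<A> \<Longrightarrow> p \<subseteq> X \<Longrightarrow> X = p"
    by blast
  have "is_prime_filter M F p"
    unfolding is_prime_filter_def is_filter_iff
  proof (intro conjI allI impI)
    show "filter_F p" "p \<noteq> carrier F"
      using p F_closed(1) by (auto simp: \<A>_def)
    fix A B assume AB: "filter_F A" "filter_F B" "p = A \<inter> B"
    have "H = carrier F \<or> H = p" if "filter_F H" "p \<subseteq> H" for H
    proof (cases "falsum F \<in> H")
      case True
      then show ?thesis
        using filter_falsum that(1) by blast
    next
      case False
      then have "H \<in> \<A>"
        using that p unfolding \<A>_def by blast
      then show ?thesis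
        using max that(2) by blast
    qed
    then have "A = carrier F \<or> A = p" "B = carrier F \<or> B = p"
      using AB by blast+
    moreover have "A \<subseteq> carrier F" "B \<subseteq> carrier F"
      using AB by (simp_all add: implicative_filter_def)
    ultimately show "p = A \<or> p = B"
      using AB(3) by blast
  qed
  with p show ?thesis
    using that by (auto simp: \<A>_def)
qed


section \<open>The topology of the spectrum\<close>

text \<open>The element \<open>d = ((a \<rightarrow> b) \<rightarrow> b) \<star> ((b \<rightarrow> a) \<rightarrow> a)\<close> serves as the join: a filter contains a product
  iff it contains both factors, so a prime filter contains \<open>d\<close> iff it contains \<open>a\<close> or \<open>b\<close>; linearity
  of the prime filter turns one of the two factors into \<open>a\<close> or \<open>b\<close>.\<close>

lemma basic_open_Int:
  assumes a: "a \<in> carrier F" and b: "b \<in> carrier F"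
  obtains d where "d \<in> carrier F" "basic_open M F d = basic_open M F a \<inter> basic_open M F b"
proof -
  let ?x = "(a \<leadsto>\<^bsub>F\<^esub> b) \<leadsto>\<^bsub>F\<^esub> b" and ?y = "(b \<leadsto>\<^bsub>F\<^esub> a) \<leadsto>\<^bsub>F\<^esub> a"
  let ?d = "?x \<otimes>\<^bsub>F\<^esub> ?y"
  have xy: "?x \<in> carrier F" "?y \<in> carrier F" "?d \<in> carrier F"
    using a b F_closed by auto
  have "?d \<in> p \<longleftrightarrow> a \<in> p \<or> b \<in> p" if "is_prime_filter M F p" for p
  proof -
    have p: "filter_F p" and lin: "a \<leadsto>\<^bsub>F\<^esub> b \<in> p \<or> b \<leadsto>\<^bsub>F\<^esub> a \<in> p"
      using that a b by (auto simp: prime_filter_iff)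
    \<comment> \<open>a filter that contains \<open>a\<close> or \<open>b\<close> contains both factors of \<open>d\<close>\<close>
    have weak: "g \<leadsto>\<^bsub>F\<^esub> f \<in> p" if "f \<in> p" "f \<in> carrier F" "g \<in> carrier F" for f g
      by (rule filter_upward[OF p that(1)]) (auto simp: that F_closed F_apply F_value le_imp)
    have twice: "(f \<leadsto>\<^bsub>F\<^esub> g) \<leadsto>\<^bsub>F\<^esub> g \<in> p" if "f \<in> p" "f \<in> carrier F" "g \<in> carrier F" for f g
      by (rule filter_upward[OF p that(1)]) (auto simp: that F_closed F_apply F_value le_imp_imp)
    have "?x \<in> p" "?y \<in> p" if "?d \<in> p"
    proof -
      show "?x \<in> p"
        by (rule filter_upward[OF p that]) (auto simp: a b F_closed F_apply F_value closed mult_le_left)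
      have "?y \<otimes>\<^bsub>F\<^esub> ?x \<in> p"
        using that F_mult_commute[of ?x ?y] xy by simp
      then show "?y \<in> p"
        by (rule filter_upward[OF p]) (auto simp: a b F_closed F_apply F_value closed mult_le_left)
    qed
    then have "?d \<in> p \<Longrightarrow> a \<in> p \<or> b \<in> p"
      using lin implicative_filter_mp[OF p] a b by blast
    moreover have "?d \<in> p" if "a \<in> p \<or> b \<in> p"
      using that weak twice filter_mult[OF p] a b F_closed(4) by meson
    ultimately show ?thesis by blast
  qed
  then have "basic_open M F ?d = basic_open M F a \<inter> basic_open M F b"
    by (auto simp: basic_open_def Spec_def)
  then show ?thesis
    using that xy by blast
qed

text \<open>The sets \<open>O\<^sub>a\<close> are a basis, which lets minimality be tested with a single element \<open>a\<close>.\<close>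

lemma open_contains_basic_open:
  assumes "openin (Spec_topology M F) U" "p \<in> U"
  obtains a where "a \<in> carrier F" "p \<in> basic_open M F a" "basic_open M F a \<subseteq> U"
proof -
  have "generate_topology_on (basic_open M F ` carrier F) U"
    using assms(1) by (simp add: Spec_topology_def openin_topology_generated_by_iff)
  then have "\<exists>a\<in>carrier F. p \<in> basic_open M F a \<and> basic_open M F a \<subseteq> U"
    using assms(2)
  proof (induction rule: generate_topology_on.induct)
    case (Int U V)
    then obtain a b where "a \<in> carrier F" "b \<in> carrier F"
      "p \<in> basic_open M F a" "basic_open M F a \<subseteq> U" "p \<in> basic_open M F b" "basic_open M F b \<subseteq> V"
      by blast
    then show ?case
      using basic_open_Int[of a b] by (metis Int_iff Int_mono)
  qed blast+
  then show ?thesis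
    using that by blast
qed

text \<open>Linearity, unlike indecomposability under intersection, is visibly preserved by preimages.\<close>

lemma dual_map_prime:
  assumes \<sigma>: "\<sigma> \<in> alg_hom F F" and p: "is_prime_filter M F p"
  shows "is_prime_filter M F (dual_map F \<sigma> p)"
proof (rule linear_filter_prime)
  have fil: "filter_F p" and "falsum F \<notin> p"
    and lin: "\<And>f g. f \<in> carrier F \<Longrightarrow> g \<in> carrier F \<Longrightarrow> f \<leadsto>\<^bsub>F\<^esub> g \<in> p \<or> g \<leadsto>\<^bsub>F\<^esub> f \<in> p"
    using p by (simp_all add: prime_filter_iff)
  note hm = alg_homD[OF \<sigma>]
  show "falsum F \<notin> dual_map F \<sigma> p"
    using \<open>falsum F \<notin> p\<close> hm(1) by (simp add: dual_map_def)
  show "filter_F (dual_map F \<sigma> p)"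
    unfolding implicative_filter_def
  proof (intro conjI ballI impI)
    show "\<one>\<^bsub>F\<^esub> \<in> dual_map F \<sigma> p"
      using fil F_closed(2) hm(2) by (simp add: dual_map_def implicative_filter_def)
    fix f g assume "f \<in> dual_map F \<sigma> p" "g \<in> carrier F" "f \<leadsto>\<^bsub>F\<^esub> g \<in> dual_map F \<sigma> p"
    then show "g \<in> dual_map F \<sigma> p"
      using implicative_filter_mp[OF fil, of "\<sigma> f" "\<sigma> g"] hm(4)[of f g] hm(5)[of g]
      by (simp add: dual_map_def)
  qed (simp add: dual_map_def)
  show "f \<leadsto>\<^bsub>F\<^esub> g \<in> dual_map F \<sigma> p \<or> g \<leadsto>\<^bsub>F\<^esub> f \<in> dual_map F \<sigma> p"
    if "f \<in> carrier F" "g \<in> carrier F" for f g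
    using that lin[of "\<sigma> f" "\<sigma> g"] hm(4,5) F_closed(4) by (simp add: dual_map_def)
qed


section \<open>Substitutions and endomorphisms\<close>

text \<open>A substitution acts on denotations by precomposition with the map
  \<open>v \<mapsto> (\<lambda>i. eval M v (\<rho> (Var i)))\<close> on points; hence its effect depends on the denoted
  element only.\<close>

lemma endomorphism_of_substitution:
  assumes \<rho>: "substitution \<rho>"
  obtains \<sigma> where "\<sigma> \<in> carrier (End F)" "\<And>r. \<sigma> (term_function r) = term_function (\<rho> r)"
proof -
  have cong: "term_function (\<rho> r) = term_function (\<rho> s)" if "term_function r = term_function s" for r s
  proof -
    have "eval M v (\<rho> r) = eval M v (\<rho> s)" if v: "v \<in> points" for v
    proof -
      have "(\<lambda>i. eval M v (\<rho> (Var i))) \<in> points"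
        using eval_M_closed[OF v] by (simp add: points_iff)
      then have "eval M (\<lambda>i. eval M v (\<rho> (Var i))) r = eval M (\<lambda>i. eval M v (\<rho> (Var i))) s"
        using fun_cong[OF \<open>term_function r = term_function s\<close>, of "\<lambda>i. eval M v (\<rho> (Var i))"] by (simp add: term_function_def)
      then show ?thesis
        using eval_substitution[OF \<rho>] by metis
    qed
    then show ?thesis
      unfolding term_function_def by (rule restrict_ext)
  qed
  define \<sigma> where "\<sigma> = (\<lambda>f\<in>carrier F. term_function (\<rho> (SOME r. term_function r = f)))"
  have \<sigma>: "\<sigma> (term_function r) = term_function (\<rho> r)" for r
  proof -
    have "term_function (SOME s. term_function s = term_function r) = term_function r"
      by (rule someI) simp
    from cong[OF this] show ?thesis
      by (simp add: \<sigma>_def carrier_F)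
  qed
  have "\<sigma> \<in> alg_hom F F"
    using \<rho> by (auto simp: alg_hom_def hom_def carrier_F term_function_operations \<sigma> substitution_def)
  then have "\<sigma> \<in> carrier (End F)"
    by (simp add: End_def \<sigma>_def)
  with \<sigma> show ?thesis
    using that by blast
qed

lemma substitution_of_endomorphism:
  assumes \<sigma>: "\<sigma> \<in> alg_hom F F"
  obtains \<rho> where "substitution \<rho>" "\<And>r. \<sigma> (term_function r) = term_function (\<rho> r)"
proof -
  have "\<forall>i. \<exists>s. \<sigma> (term_function (Var i)) = term_function s"
    using alg_homD(5)[OF \<sigma>] by (auto simp: carrier_F)
  then obtain \<theta> where \<theta>: "\<And>i. \<sigma> (term_function (Var i)) = term_function (\<theta> i)"
    by metis
  have "\<sigma> (term_function r) = term_function (instantiate \<theta> r)" for r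
  proof -
    have "\<sigma> (term_function r) = \<sigma> (eval F (\<lambda>i. term_function (Var i)) r)"
      by (simp add: eval_F_term_function instantiate_Var)
    also have "\<dots> = eval F (\<sigma> \<circ> (\<lambda>i. term_function (Var i))) r"
      by (rule alg_hom_eval[OF is_algebra_F \<sigma>]) (simp add: carrier_F)
    also have "\<dots> = term_function (instantiate \<theta> r)"
      by (simp add: comp_def \<theta> eval_F_term_function)
    finally show ?thesis .
  qed
  then show ?thesis
    using that substitution_instantiate by blast
qed


section \<open>Completeness and minimality\<close>

text \<open>The induction needs the claim for all substitution instances of a deduced formula at
  once, since a deduction may apply the substitution rule at any step.\<close>

lemma deducible_in_filter:
  assumes p: "filter_F p"
    and inst: "\<And>\<rho>. substitution \<rho> \<Longrightarrow> term_function (\<rho> r) \<in> p"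
    and ded: "deducible ({r. true_in M r} \<union> {r}) s"
  shows "term_function s \<in> p"
proof -
  have "\<forall>\<rho>. substitution \<rho> \<longrightarrow> term_function (\<rho> s) \<in> p"
    using ded
  proof (induction rule: deducible_induct)
    case (base t)
    show ?case
    proof (intro allI impI)
      fix \<rho> assume \<rho>: "substitution \<rho>"
      consider "t = r" | "true_in M t"
        using base by blast
      then show "term_function (\<rho> t) \<in> p"
      proof cases
        case 2
        obtain \<sigma> where \<sigma>: "\<sigma> \<in> carrier (End F)" "\<And>r. \<sigma> (term_function r) = term_function (\<rho> r)"
          using endomorphism_of_substitution[OF \<rho>] by blast
        then have "\<sigma> \<one>\<^bsub>F\<^esub> = \<one>\<^bsub>F\<^esub>"
          by (auto simp: End_def alg_hom_def)
        then have "term_function (\<rho> t) = \<one>\<^bsub>F\<^esub>"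
          using 2 \<sigma>(2) by (metis true_in_iff)
        then show ?thesis
          using p by (simp add: implicative_filter_def)
      qed (use inst \<rho> in blast)
    qed
  next
    case (mp t u)
    show ?case
    proof (intro allI impI)
      fix \<rho> assume \<rho>: "substitution \<rho>"
      then have "term_function (\<rho> t) \<leadsto>\<^bsub>F\<^esub> term_function (\<rho> u) \<in> p"
        using mp(2) by (simp add: term_function_operations substitution_def)
      then show "term_function (\<rho> u) \<in> p"
        using implicative_filter_mp[OF p] mp(1) \<rho> carrier_F by blast
    qed
  next
    case (substitution t \<sigma>)
    then show ?case
      using substitution_comp by blast
  qed
  moreover have "substitution (\<lambda>t. t)"
    by (simp add: substitution_def)
  ultimately show ?thesis
    by blast
qed

text \<open>Formulas with the same denotation are interderivable, so deducibility can be transferred to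
  the free algebra.\<close>

lemma deducible_equivalent:
  assumes ded: "deducible \<Theta> r" and \<Theta>: "{r. true_in M r} \<subseteq> \<Theta>"
    and eq: "term_function r = term_function s"
  shows "deducible \<Theta> s"
proof -
  have "term_function (Imp r s) = \<one>\<^bsub>F\<^esub>"
    using F_imp_eq_one_iff[of "term_function r" "term_function s"] eq
    by (simp add: carrier_F flip: term_function_operations(4))
  then have "Imp r s \<in> \<Theta>"
    using \<Theta> true_in_iff by blast
  then show ?thesis
    using ded deducible_base deducible_mp by blast
qed

lemma filter_deducible:
  assumes \<Theta>: "{r. true_in M r} \<subseteq> \<Theta>"
  shows "filter_F (term_function ` {r. deducible \<Theta> r})"
  unfolding implicative_filter_def
proof (intro conjI ballI impI)
  show "\<one>\<^bsub>F\<^esub> \<in> term_function ` {r. deducible \<Theta> r}"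
    using \<Theta> by (auto simp: term_function_operations true_in_def intro!: imageI deducible_base)
  fix a b assume "a \<in> term_function ` {r. deducible \<Theta> r}" "b \<in> carrier F"
    "a \<leadsto>\<^bsub>F\<^esub> b \<in> term_function ` {r. deducible \<Theta> r}"
  then obtain r s t where "deducible \<Theta> r" "a = term_function r" "b = term_function s"
    "deducible \<Theta> t" "term_function (Imp r s) = term_function t"
    by (auto simp: carrier_F term_function_operations)
  then have "deducible \<Theta> s"
    using deducible_equivalent[OF _ \<Theta>] deducible_mp by metis
  then show "b \<in> term_function ` {r. deducible \<Theta> r}"
    using \<open>b = _\<close> by blast
qed (auto simp: carrier_F)

text \<open>From completeness to minimality: if all instances of \<open>a \<noteq> 1\<close> lay in a prime \<open>q\<close>, so would the
  deducible formula \<open>0\<close>. Conversely, if the filter \<open>G\<close> of deducible formulas is proper, it lies in a prime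
  \<open>q\<close>, and minimality moves \<open>q\<close> into \<open>O\<^bsub>[r]\<^esub>\<close>, that is, yields an instance of \<open>r\<close> outside \<open>q \<supseteq> G\<close>.\<close>

theorem complete_iff_minimal:
  "equationally_complete {r. true_in M r} \<longleftrightarrow> acts_minimally M F (carrier (End F))"
proof
  assume complete: "equationally_complete {r. true_in M r}"
  show "acts_minimally M F (carrier (End F))"
    unfolding acts_minimally_def
  proof (intro allI impI)
    fix U assume U: "openin (Spec_topology M F) U" "U \<noteq> {}"
    then obtain p0 a where a: "a \<in> carrier F" "p0 \<in> basic_open M F a" "basic_open M F a \<subseteq> U"
      using open_contains_basic_open by blast
    then obtain r where r: "a = term_function r"
      by (auto simp: carrier_F)
    have "a \<noteq> \<one>\<^bsub>F\<^esub>"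
      using a(2) by (auto simp: basic_open_def Spec_def prime_filter_iff implicative_filter_def)
    then have "r \<notin> {r. true_in M r}"
      by (simp add: r true_in_iff)
    then have ded: "deducible ({r. true_in M r} \<union> {r}) Falsum"
      using complete unfolding equationally_complete_def by blast
    have "\<exists>\<sigma>\<in>carrier (End F). dual_map F \<sigma> q \<in> U" if "q \<in> Spec M F" for q
    proof -
      have q: "is_prime_filter M F q"
        using that by (simp add: Spec_def)
      then have "filter_F q" "term_function Falsum \<notin> q"
        by (auto simp: prime_filter_iff term_function_operations)
      then obtain \<rho> where \<rho>: "substitution \<rho>" "term_function (\<rho> r) \<notin> q"
        using deducible_in_filter ded by blast
      then obtain \<sigma> where \<sigma>: "\<sigma> \<in> carrier (End F)" "\<sigma> a \<notin> q"
        using endomorphism_of_substitution r by metis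
      then have "is_prime_filter M F (dual_map F \<sigma> q)"
        using dual_map_prime q by (auto simp: End_def)
      then have "dual_map F \<sigma> q \<in> basic_open M F a"
        using \<sigma>(2) by (simp add: basic_open_def Spec_def dual_map_def)
      then show ?thesis
        using \<sigma>(1) a(3) by blast
    qed
    then show "saturation M F (carrier (End F)) U = Spec M F"
      by (auto simp: saturation_def generated_submonoid_End[OF is_algebra_F])
  qed
next
  assume minimal: "acts_minimally M F (carrier (End F))"
  show "equationally_complete {r. true_in M r}"
    unfolding equationally_complete_def
  proof (intro allI impI)
    fix r s assume r: "r \<notin> {r. true_in M r}"
    define \<Theta> where "\<Theta> = {r. true_in M r} \<union> {r}"
    have \<Theta>: "{r. true_in M r} \<subseteq> \<Theta>"
      by (auto simp: \<Theta>_def)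
    define G where "G = term_function ` {t. deducible \<Theta> t}"
    have G: "filter_F G"
      using filter_deducible[OF \<Theta>] by (simp add: G_def)
    have "falsum F \<in> G"
    proof (rule ccontr)
      assume "falsum F \<notin> G"
      then obtain q where q: "is_prime_filter M F q" "G \<subseteq> q"
        using prime_filter_extends G by blast
      let ?U = "basic_open M F (term_function r)"
      have "openin (Spec_topology M F) ?U"
        unfolding Spec_topology_def
        by (rule topology_generated_by_Basis) (simp add: carrier_F)
      moreover have "?U \<noteq> {}"
        using basic_open_nonempty r by simp
      ultimately have "saturation M F (carrier (End F)) ?U = Spec M F"
        using minimal unfolding acts_minimally_def by blast
      then obtain \<sigma> where \<sigma>: "\<sigma> \<in> carrier (End F)" "dual_map F \<sigma> q \<in> ?U"
        using q(1) by (auto simp: saturation_def generated_submonoid_End[OF is_algebra_F] Spec_def)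
      then obtain \<rho> where \<rho>: "substitution \<rho>" "\<And>r. \<sigma> (term_function r) = term_function (\<rho> r)"
        using substitution_of_endomorphism[of \<sigma>] by (auto simp: End_def)
      have "term_function (\<rho> r) \<notin> q"
        using \<sigma>(2) \<rho>(2) by (auto simp: basic_open_def dual_map_def carrier_F)
      moreover have "deducible \<Theta> (\<rho> r)"
        by (rule deducible_substitution[OF deducible_base \<rho>(1)]) (simp add: \<Theta>_def)
      ultimately show False
        using q(2) unfolding G_def by blast
    qed
    then have "term_function s \<in> G"
      using filter_falsum[OF G] by (auto simp: carrier_F)
    then show "deducible ({r. true_in M r} \<union> {r}) s"
      using deducible_equivalent[OF _ \<Theta>] unfolding G_def \<Theta>_def by (metis imageE mem_Collect_eq)
  qed
qed

end


section \<open>Truth-value algebras are residuated chains\<close>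

text \<open>By continuity the set of all \<open>c\<close> with \<open>c \<star> a \<le> b\<close> is closed, so it contains its supremum; it is
  downward closed by monotonicity.\<close>

lemma t_norm_residuation:
  assumes t: "t_norm star" and a: "a \<in> {0..1}" and b: "b \<in> {0..1}"
  shows "residuum star a b \<in> {0..1}"
    and "c \<in> {0..1} \<Longrightarrow> star c a \<le> b \<longleftrightarrow> c \<le> residuum star a b"
proof -
  interpret I: comm_monoid "\<lparr>carrier = {0..1}, mult = star, one = 1\<rparr>"
    using t by (simp add: t_norm_def)
  have comm: "star x y = star y x" if "x \<in> {0..1}" "y \<in> {0..1}" for x y
    using I.m_comm that by simp
  have mono: "star x z \<le> star y z" if "x \<in> {0..1}" "y \<in> {0..1}" "z \<in> {0..1}" "x \<le> y" for x y z
    using t that comm unfolding t_norm_def by metis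
  let ?C = "{c \<in> {0..1}. star c a \<le> b}"
  have "star 0 a \<le> star 0 1"
    using t a unfolding t_norm_def by auto
  also have "star 0 1 = 0"
    using I.r_one[of 0] by simp
  finally have "0 \<in> ?C"
    using b by simp
  have "continuous_on ({0..1} \<times> {0..1}) (\<lambda>(a, b). star a b)"
    using t by (simp add: t_norm_def)
  moreover have "continuous_on {0..1::real} (\<lambda>c. (c, a))"
    by (intro continuous_intros)
  moreover have "(\<lambda>c. (c, a)) ` {0..1} \<subseteq> {0..1} \<times> {0..1}"
    using a by blast
  ultimately have "continuous_on {0..1} (\<lambda>c. (\<lambda>(a, b). star a b) (c, a))"
    by (rule continuous_on_compose2)
  then have "closed ({0..1} \<inter> (\<lambda>c. star c a) -` {..b})"
    using continuous_closed_preimage[of "{0..1}" "\<lambda>c. star c a" "{..b}"] by simp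
  moreover have "{0..1} \<inter> (\<lambda>c. star c a) -` {..b} = ?C"
    by auto
  ultimately have "closed ?C"
    by simp
  moreover have bdd: "bdd_above ?C"
    by (rule bdd_aboveI[of _ 1]) auto
  ultimately have "Sup ?C \<in> ?C"
    using closed_contains_Sup[of ?C] \<open>0 \<in> ?C\<close> by blast
  then have res: "residuum star a b \<in> ?C"
    by (simp only: residuum_def)
  then show "residuum star a b \<in> {0..1}"
    by blast
  assume c: "c \<in> {0..1}"
  show "star c a \<le> b \<longleftrightarrow> c \<le> residuum star a b"
  proof
    assume "star c a \<le> b"
    then have "c \<in> ?C"
      using c by simp
    then show "c \<le> residuum star a b"
      unfolding residuum_def using bdd by (rule cSup_upper)
  next
    assume "c \<le> residuum star a b"
    then show "star c a \<le> b"
      using mono[of c "residuum star a b" a] res c a by auto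
  qed
qed

lemma residuated_chain_truth_value_algebra:
  assumes "truth_value_algebra M"
  shows "residuated_chain M"
proof -
  obtain star S where t: "t_norm star" and S: "subuniverse S (unit_interval_alg star)"
    and M: "M = (unit_interval_alg star)\<lparr>carrier := S\<rparr>"
    using assms unfolding truth_value_algebra_def by blast
  interpret I: comm_monoid "\<lparr>carrier = {0..1}, mult = star, one = 1\<rparr>"
    using t by (simp add: t_norm_def)
  have S01: "x \<in> {0..1}" if "x \<in> S" for x
    using S that by (auto simp: subuniverse_def unit_interval_alg_def)
  have M_simps: "carrier M = S" "mult M = star" "\<one>\<^bsub>M\<^esub> = 1" "imp M = residuum star" "falsum M = 0"
    by (simp_all add: M unit_interval_alg_def)
  show ?thesis
  proof
    show alg: "is_algebra M"
      using S by (simp add: is_algebra_def subuniverse_def M unit_interval_alg_def)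
    show "x \<otimes>\<^bsub>M\<^esub> y \<in> carrier M" if "x \<in> carrier M" "y \<in> carrier M" for x y
      using algebra_closed(3)[OF alg] that .
    show "\<one>\<^bsub>M\<^esub> \<in> carrier M"
      using algebra_closed(2)[OF alg] .
    show "x \<otimes>\<^bsub>M\<^esub> y \<otimes>\<^bsub>M\<^esub> z = x \<otimes>\<^bsub>M\<^esub> (y \<otimes>\<^bsub>M\<^esub> z)"
      if "x \<in> carrier M" "y \<in> carrier M" "z \<in> carrier M" for x y z
      using I.m_assoc[of x y z] S01 that by (simp add: M_simps)
    show "x \<otimes>\<^bsub>M\<^esub> y = y \<otimes>\<^bsub>M\<^esub> x" if "x \<in> carrier M" "y \<in> carrier M" for x y
      using I.m_comm[of x y] S01 that by (simp add: M_simps)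
    show "\<one>\<^bsub>M\<^esub> \<otimes>\<^bsub>M\<^esub> x = x" "x \<otimes>\<^bsub>M\<^esub> \<one>\<^bsub>M\<^esub> = x" if "x \<in> carrier M" for x
      using I.l_one[of x] I.r_one[of x] S01 that by (simp_all add: M_simps)
    show "c \<otimes>\<^bsub>M\<^esub> a \<le> b \<longleftrightarrow> c \<le> a \<leadsto>\<^bsub>M\<^esub> b"
      if "a \<in> carrier M" "b \<in> carrier M" "c \<in> carrier M" for a b c
      using t_norm_residuation(2)[OF t] S01 that by (simp add: M_simps)
    show "falsum M \<le> a" "a \<le> \<one>\<^bsub>M\<^esub>" if "a \<in> carrier M" for a
      using S01 that by (auto simp: M_simps)
    show "falsum M \<noteq> \<one>\<^bsub>M\<^esub>"
      by (simp add: M_simps)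
  qed
qed

theorem theorem4p5:
  fixes M :: "real alg"
  assumes "truth_value_algebra M"
  shows "equationally_complete {r. true_in M r} \<longleftrightarrow>
         acts_minimally M (free_alg M) (carrier (End (free_alg M)))"
  using residuated_chain.complete_iff_minimal[OF residuated_chain_truth_value_algebra[OF assms]] .

end
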